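(* Let $1<\lambda<2$ and $\alpha=2-\lambda$. Suppose $P<0$, and let $\psi$ be a $2\pi$-periodic solution of $$-\lambda\psi\psi''+(\lambda-1)(\psi')^2-\lambda^2\psi^2+2(\lambda-1)P=0$$ obtained by gluing $2k$ maximal local solutions. Consider the corresponding homogeneous steady state of the two-dimensional Euler equations with stream function $\Psi=r^\lambda\psi(\theta)$. Then the pseudo-velocity field $\nabla^\perp\Psi-\frac{\xi}{\alpha}$ has a stagnation point at each angle $\theta$ where $\psi(\theta)$ changes sign from positive to negative. Moreover, all $k$ stagnation points other than the origin are sinks located at a distance of $\alpha^{\frac1\alpha}(-2P)^{\frac{1}{2\alpha}}$ from the origin. Finally, the origin is a saddle point.
   Context: $(r,\theta)$ are polar coordinates of $\xi\in\mathbb{R}^2$, and $\nabla^\perp f=(-\partial_yf,\partial_xf)$, so $\nabla^\perp(r^\lambda\psi(\theta))=r^{\lambda-1}(-\psi'\mathbf{e}_r+\lambda\psi\,\mathbf{e}_\theta)$. On an interval where a solution $\psi$ of the displayed ODE is positive, $B=(2P+(\psi')^2+\lambda^2\psi^2)\psi^{\frac2\lambda-2}$ is constant; local solutions are normalized to $B=\pm1$. For $P<0$, $\psi_+$ and $\psi_-$ denote the maximal positive local solutions (unique up to translation) with $B=1$ and $B=-1$ respectively, so $(\psi_\pm')^2=-2P\pm\psi_\pm^{2-\frac2\lambda}-\lambda^2\psi_\pm^2$; each is defined on a bounded interval, is positive inside, and vanishes at both endpoints. Gluing $2k$ maximal local solutions means taking $\phi_1,\dots,\phi_{2k}$, each a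 copy of $\psi_+$ or $\psi_-$ and all with the same $P$, and concatenating $\phi_1,-\phi_2,\phi_3,\dots,-\phi_{2k}$ on consecutive intervals whose lengths sum to $2\pi$; the result is a $2\pi$-periodic $C^1$ function solving the ODE (classically where $\psi\ne0$, weakly across the zeros). A stagnation point is a zero of the pseudo-velocity field. A sink is an attracting (asymptotically stable) stagnation point. The origin is a saddle if the flow of the pseudo-velocity enters the origin along some rays and leaves it along other rays. *)

theory Defs
  imports "HOL-Analysis.Analysis"
begin

text \<open>The plane is identified with the type of complex numbers, so that polar coordinates are
  \<open>\<xi> = rcis r \<theta>\<close>.\<close>

subsection \<open>The angular equation\<close>

definition angular_ode_at :: "real \<Rightarrow> real \<Rightarrow> (real \<Rightarrow> real) \<Rightarrow> real \<Rightarrow> bool" where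
  "angular_ode_at lam P \<psi> \<theta> \<longleftrightarrow>
     \<psi> differentiable (at \<theta>) \<and> deriv \<psi> differentiable (at \<theta>) \<and>
     - lam * \<psi> \<theta> * deriv (deriv \<psi>) \<theta> + (lam - 1) * (deriv \<psi> \<theta>)\<^sup>2
       - lam\<^sup>2 * (\<psi> \<theta>)\<^sup>2 + 2 * (lam - 1) * P = 0"

definition bernoulli :: "real \<Rightarrow> real \<Rightarrow> (real \<Rightarrow> real) \<Rightarrow> real \<Rightarrow> real" where
  "bernoulli lam P \<psi> \<theta> =
     (2 * P + (deriv \<psi> \<theta>)\<^sup>2 + lam\<^sup>2 * (\<psi> \<theta>)\<^sup>2) * \<psi> \<theta> powr (2 / lam - 2)"

definition positive_local_solution ::
    "real \<Rightarrow> real \<Rightarrow> real \<Rightarrow> (real \<Rightarrow> real) \<Rightarrow> real \<Rightarrow> real \<Rightarrow> bool" where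
  "positive_local_solution lam P B \<phi> a b \<longleftrightarrow> a < b \<and>
     (\<forall>\<theta>\<in>{a<..<b}. \<phi> \<theta> > 0 \<and> angular_ode_at lam P \<phi> \<theta> \<and> bernoulli lam P \<phi> \<theta> = B)"

definition maximal_local_solution ::
    "real \<Rightarrow> real \<Rightarrow> real \<Rightarrow> (real \<Rightarrow> real) \<Rightarrow> real \<Rightarrow> real \<Rightarrow> bool" where
  "maximal_local_solution lam P B \<phi> a b \<longleftrightarrow> positive_local_solution lam P B \<phi> a b \<and>
     (\<forall>\<eta> a' b'. a' \<le> a \<longrightarrow> b \<le> b' \<longrightarrow> positive_local_solution lam P B \<eta> a' b' \<longrightarrow>
        (\<forall>\<theta>\<in>{a<..<b}. \<eta> \<theta> = \<phi> \<theta>) \<longrightarrow> a' = a \<and> b' = b)"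

text \<open>The \<open>i\<close>-th piece, counted from \<open>0\<close>, lives on \<open>{t i<..<t (Suc i)}\<close> and carries the
  sign \<open>(-1) ^ i\<close>. For \<open>P < 0\<close> the maximal local solutions vanish at both endpoints; this
  is recorded by the continuity of \<open>\<psi>\<close> and its zeros at the nodes \<open>t i\<close>. The pieces are
  translates of the two normalized maximal solutions, with \<open>B = 1\<close> and \<open>B = -1\<close>; the choice
  may vary from piece to piece.\<close>

definition glued_solution :: "real \<Rightarrow> real \<Rightarrow> nat \<Rightarrow> (real \<Rightarrow> real) \<Rightarrow> bool" where
  "glued_solution lam P k \<psi> \<longleftrightarrow>
     continuous_on UNIV \<psi> \<and> (\<forall>\<theta>. \<psi> (\<theta> + 2 * pi) = \<psi> \<theta>) \<and>
     (\<exists>t :: nat \<Rightarrow> real. t (2 * k) = t 0 + 2 * pi \<and> (\<forall>i\<le>2 * k. \<psi> (t i) = 0) \<and>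
        (\<forall>i<2 * k. \<exists>B\<in>{1, -1}.
           maximal_local_solution lam P B (\<lambda>\<theta>. (-1) ^ i * \<psi> \<theta>) (t i) (t (Suc i))))"

definition changes_pos_to_neg_at :: "(real \<Rightarrow> real) \<Rightarrow> real \<Rightarrow> bool" where
  "changes_pos_to_neg_at \<psi> \<theta> \<longleftrightarrow>
     (\<forall>\<^sub>F s in at_left \<theta>. \<psi> s > 0) \<and> (\<forall>\<^sub>F s in at_right \<theta>. \<psi> s < 0)"

subsection \<open>The pseudo-velocity field\<close>

definition perp_grad :: "(complex \<Rightarrow> real) \<Rightarrow> complex \<Rightarrow> complex" where
  "perp_grad f \<xi> =
     Complex (- deriv (\<lambda>y. f (Complex (Re \<xi>) y)) (Im \<xi>)) (deriv (\<lambda>x. f (Complex x (Im \<xi>))) (Re \<xi>))"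

text \<open>For \<open>2\<pi>\<close>-periodic \<open>\<psi>\<close> the choice of the branch of the angle is immaterial.\<close>

definition homogeneous_stream :: "real \<Rightarrow> (real \<Rightarrow> real) \<Rightarrow> complex \<Rightarrow> real" where
  "homogeneous_stream lam \<psi> \<xi> = cmod \<xi> powr lam * \<psi> (Arg \<xi>)"

definition pseudo_velocity :: "real \<Rightarrow> (complex \<Rightarrow> real) \<Rightarrow> complex \<Rightarrow> complex" where
  "pseudo_velocity \<alpha> \<Psi> \<xi> = perp_grad \<Psi> \<xi> - \<xi> /\<^sub>R \<alpha>"

subsection \<open>Stagnation points, sinks and saddles\<close>

definition stagnation_point :: "(complex \<Rightarrow> complex) \<Rightarrow> complex \<Rightarrow> bool" where
  "stagnation_point F p \<longleftrightarrow> F p = 0"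

definition trajectory_on :: "(complex \<Rightarrow> complex) \<Rightarrow> (real \<Rightarrow> complex) \<Rightarrow> real set \<Rightarrow> bool" where
  "trajectory_on F x I \<longleftrightarrow> (\<forall>t\<in>I. (x has_vector_derivative F (x t)) (at t within I))"

text \<open>The pseudo-velocity is only Hoelder continuous in general (the second derivative of
  \<open>\<psi>\<close> blows up at its zeros), so asymptotic stability is stated for all trajectories, and
  their existence for all positive times is part of the definition.\<close>

definition asymptotically_stable :: "(complex \<Rightarrow> complex) \<Rightarrow> complex \<Rightarrow> bool" where
  "asymptotically_stable F p \<longleftrightarrow>
     (\<forall>\<epsilon>>0. \<exists>\<delta>>0. \<forall>x T. trajectory_on F x {0..<T} \<longrightarrow> x 0 \<in> ball p \<delta> \<longrightarrow>
        (\<forall>t\<in>{0..<T}. x t \<in> ball p \<epsilon>)) \<and>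
     (\<exists>\<delta>>0. \<forall>x0\<in>ball p \<delta>.
        (\<exists>x. trajectory_on F x {0..} \<and> x 0 = x0) \<and>
        (\<forall>x. trajectory_on F x {0..} \<longrightarrow> x 0 = x0 \<longrightarrow> (x \<longlongrightarrow> p) at_top))"

definition sink :: "(complex \<Rightarrow> complex) \<Rightarrow> complex \<Rightarrow> bool" where
  "sink F p \<longleftrightarrow> stagnation_point F p \<and> asymptotically_stable F p"

definition open_ray :: "real \<Rightarrow> complex set" where
  "open_ray \<theta> = {rcis r \<theta> |r. r > 0}"

text \<open>Trajectories enter and leave the origin in finite time: the field is not Lipschitz
  continuous there. By the intermediate value theorem one such trajectory passes through all
  points of the ray close to the origin.\<close>

definition enters_origin_along :: "(complex \<Rightarrow> complex) \<Rightarrow> real \<Rightarrow> bool" where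
  "enters_origin_along F \<theta> \<longleftrightarrow>
     (\<exists>a b x. a < b \<and> trajectory_on F x {a..<b} \<and> (\<forall>t\<in>{a..<b}. x t \<in> open_ray \<theta>) \<and>
        (x \<longlongrightarrow> 0) (at_left b))"

definition leaves_origin_along :: "(complex \<Rightarrow> complex) \<Rightarrow> real \<Rightarrow> bool" where
  "leaves_origin_along F \<theta> \<longleftrightarrow>
     (\<exists>a b x. a < b \<and> trajectory_on F x {a<..b} \<and> (\<forall>t\<in>{a<..b}. x t \<in> open_ray \<theta>) \<and>
        (x \<longlongrightarrow> 0) (at_right a))"

definition origin_is_saddle :: "(complex \<Rightarrow> complex) \<Rightarrow> bool" where
  "origin_is_saddle F \<longleftrightarrow> stagnation_point F 0 \<and>
     (\<exists>\<theta>\<^sub>1 \<theta>\<^sub>2. open_ray \<theta>\<^sub>1 \<noteq> open_ray \<theta>\<^sub>2 \<and>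
        enters_origin_along F \<theta>\<^sub>1 \<and> leaves_origin_along F \<theta>\<^sub>2)"

end

theory Submission
  imports Defs
begin

text \<open>Write \<open>m = sqrt (- 2 * P)\<close>. At a zero of \<open>\<psi>\<close> the relation \<open>B = const\<close> degenerates to
  \<open>(\<psi>')\<^sup>2 = m\<^sup>2\<close>, so the glued profile is differentiable at its nodes, with slope \<open>m\<close> at the
  even and \<open>-m\<close> at the odd ones, and \<open>\<psi>'\<close> is continuous there
  (\<open>glued_solution_nodal_profile\<close>). In polar coordinates the pseudo-velocity at
  \<open>\<xi> = rcis r \<theta>\<close> is \<open>\<xi>\<close> times
  \<open>- \<psi>' \<theta> * r powr - \<alpha> - 1 / \<alpha> + \<i> * lam * \<psi> \<theta> * r powr - \<alpha>\<close>
  (\<open>pseudo_velocity_rcis\<close>). It vanishes off the origin exactly where \<open>\<psi> = 0\<close> and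
  \<open>r powr \<alpha> = - \<alpha> * \<psi>' \<theta>\<close>, that is, at the odd nodes with \<open>r powr \<alpha> = \<alpha> * m\<close>; there are
  \<open>k\<close> of these in a period (\<open>stagnation_points\<close>).

  Let \<open>p\<close> be one of these points, on the ray of angle \<open>\<theta>\<^sub>0\<close>. With \<open>q = (r / \<bar>p\<bar>) powr \<alpha>\<close>,
  \<open>\<tau> = \<theta> - \<theta>\<^sub>0\<close> and \<open>f \<tau> = \<psi> (\<theta>\<^sub>0 + \<tau>) / m\<close>, so that \<open>f 0 = 0\<close> and \<open>f' 0 = -1\<close>, the flow becomes
  \<open>q' = - f' \<tau> - q\<close> and \<open>\<tau>' = (lam / \<alpha>) * f \<tau> / q\<close>. The first equation is linear in \<open>q\<close> and
  pulls \<open>q\<close> towards \<open>- f' \<tau>\<close>, which is near \<open>1\<close>; the second pulls \<open>\<tau>\<close> towards \<open>0\<close>. Hence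
  small boxes around \<open>p\<close> in the coordinate \<open>w = Ln (\<xi> / p) = ln q / \<alpha> + \<i> * \<tau>\<close> trap every
  trajectory (\<open>box_image_invariant\<close>), first \<open>\<tau>\<close> and then \<open>q - 1\<close> decays
  (\<open>box_image_attracted\<close>), and so \<open>p\<close> is stable and attracting.

  Since \<open>f'\<close> is in general not Lipschitz at \<open>0\<close>, neither is the field at \<open>p\<close>, and trajectories
  cannot be found by Picard iteration. Instead the equations are integrated by quadrature
  (\<open>solution_exists_left\<close>): the stream function decays like \<open>exp (- lam * t / \<alpha>)\<close> along every
  trajectory, so on the side \<open>\<tau> < 0\<close>, where \<open>f\<close> is positive, \<open>q * exp t * f \<tau> powr (\<alpha> / lam)\<close>
  is constant. Eliminating \<open>q\<close> leaves
  \<open>y' = f y powr (2 / lam)\<close> in a new time that is proportional to \<open>exp t - 1\<close>. As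
  \<open>2 / lam > 1\<close>, its solution never reaches the equilibrium \<open>0\<close>, and so it exists for all
  times.

  Along a ray on which \<open>\<psi> = 0\<close> the quantity \<open>g = r powr \<alpha>\<close> satisfies \<open>g' = - \<alpha> * \<psi>' \<theta> - g\<close>.
  This solution of a linear equation reaches \<open>g = 0\<close> in finite time, forwards if \<open>\<psi>' \<theta> = m\<close> and
  backwards if \<open>\<psi>' \<theta> = - m\<close>, which makes the origin a saddle.\<close>

section \<open>Scalar differential inequalities and equations\<close>

text \<open>For a constant bound \<open>c * d\<close> on the forcing \<open>g\<close>, the function \<open>exp (c * t) * (V t - d)\<close> is
  nonincreasing; the forcing eventually obeys such a bound for every \<open>d > 0\<close>.\<close>

lemma decay_of_forced_inequality:
  fixes V V' g :: "real \<Rightarrow> real"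
  assumes der: "\<And>t. 0 \<le> t \<Longrightarrow> (V has_real_derivative V' t) (at t within {0..})"
    and ineq: "\<And>t. 0 \<le> t \<Longrightarrow> V' t \<le> - c * V t + g t"
    and nonneg: "\<And>t. 0 \<le> t \<Longrightarrow> 0 \<le> V t"
    and "0 < c" and g: "(g \<longlongrightarrow> 0) at_top"
  shows "(V \<longlongrightarrow> 0) at_top"
proof (rule tendstoI)
  fix e :: real assume "0 < e"
  define d where "d = e / 2"
  have d: "0 < d" using \<open>0 < e\<close> by (simp add: d_def)
  have "\<forall>\<^sub>F t in at_top. g t < c * d"
    using order_tendstoD(2)[OF g] \<open>0 < c\<close> d by simp
  then obtain T0 where T0: "\<And>t. T0 \<le> t \<Longrightarrow> g t < c * d"
    by (auto simp: eventually_at_top_linorder)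
  define T where "T = max T0 1"
  have gT: "g t \<le> c * d" if "T \<le> t" for t using T0[of t] that by (simp add: T_def)
  have T: "0 < T" by (simp add: T_def)
  define E where "E t = exp (c * t) * (V t - d)" for t
  have mono: "E t \<le> E T" if "T \<le> t" for t
  proof (rule DERIV_nonpos_imp_nonincreasing[OF that])
    fix s assume s: "T \<le> s" "s \<le> t"
    then have "0 < s" using T by simp
    then have "s \<in> interior {0..}" by simp
    then have "(V has_real_derivative V' s) (at s)"
      using der[of s] \<open>0 < s\<close> at_within_interior[of s "{0..}"] by simp
    then have "(E has_real_derivative exp (c * s) * (V' s + c * (V s - d))) (at s)"
      unfolding E_def by (auto intro!: derivative_eq_intros simp: algebra_simps)
    moreover have "V' s + c * (V s - d) \<le> 0"
      using ineq[of s] gT[OF s(1)] \<open>0 < s\<close> by (simp add: algebra_simps)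
    then have "exp (c * s) * (V' s + c * (V s - d)) \<le> 0"
      by (simp add: mult_nonneg_nonpos)
    ultimately show "\<exists>y. (E has_real_derivative y) (at s) \<and> y \<le> 0" by blast
  qed
  have bound: "V t \<le> d + E T * exp (- (c * t))" if "T \<le> t" for t
  proof -
    have "V t - d = E t * exp (- (c * t))"
      by (simp add: E_def exp_minus field_simps)
    also have "\<dots> \<le> E T * exp (- (c * t))"
      using mono[OF that] by (simp add: mult_right_mono)
    finally show ?thesis by simp
  qed
  have "((\<lambda>t. d + E T * exp (- (c * t))) \<longlongrightarrow> d + E T * 0) at_top"
    by (intro tendsto_intros filterlim_compose[OF exp_at_bot]
        filterlim_uminus_at_bot_at_top[THEN filterlim_compose]
        filterlim_tendsto_pos_mult_at_top[OF tendsto_const \<open>0 < c\<close> filterlim_ident])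
  then have "\<forall>\<^sub>F t in at_top. d + E T * exp (- (c * t)) < e"
    using order_tendstoD(2) \<open>0 < e\<close> by (force simp: d_def)
  then show "\<forall>\<^sub>F t in at_top. dist (V t) 0 < e"
    using eventually_ge_at_top[of T]
  proof eventually_elim
    case (elim t)
    with bound[of t] nonneg[of t] T show ?case by (simp add: dist_real_def)
  qed
qed

text \<open>Separation of variables: with \<open>J\<close> an antiderivative of \<open>1 / g\<close>, the solution is
  \<open>y s = J\<^sup>-\<^sup>1 (J y0 + s)\<close>. It exists for all positive times because the linear bound on \<open>g\<close> near
  the right end point makes \<open>J\<close> unbounded there. The base point \<open>c\<close> of the integral lies to the
  left of \<open>y0\<close>, so that the derivative at time \<open>0\<close> is two-sided.\<close>

lemma scalar_flow_towards_equilibrium: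
  fixes g :: "real \<Rightarrow> real"
  assumes cont: "continuous_on {a<..<b} g"
    and pos: "\<And>y. a < y \<Longrightarrow> y < b \<Longrightarrow> 0 < g y"
    and lin: "\<And>y. a < y \<Longrightarrow> y < b \<Longrightarrow> g y \<le> L * (b - y)"
    and y0: "a < y0" "y0 < b"
  obtains y where "y 0 = y0" "\<And>s. 0 \<le> s \<Longrightarrow> a < y s \<and> y s < b"
    "\<And>s. 0 \<le> s \<Longrightarrow> (y has_real_derivative g (y s)) (at s)"
proof -
  define c where "c = (a + y0) / 2"
  have c: "a < c" "c < y0" using y0 by (auto simp: c_def)
  define J where "J y = integral {c..y} (\<lambda>z. 1 / g z)" for y
  have "L > 0"
    using pos[OF y0] lin[OF y0] y0 by (metis diff_gt_0_iff_gt less_le_trans zero_less_mult_pos2)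
  have contg: "continuous_on {c..d} (\<lambda>z. 1 / g z)" if "d < b" for d
  proof (intro continuous_intros continuous_on_subset[OF cont] ballI)
    show "{c..d} \<subseteq> {a<..<b}" using c that by auto
    show "g z \<noteq> 0" if "z \<in> {c..d}" for z using pos[of z] c that \<open>d < b\<close> by auto
  qed
  have J_der: "(J has_real_derivative 1 / g y) (at y)" if "c < y" "y < b" for y
  proof -
    obtain d where d: "y < d" "d < b" using dense[OF \<open>y < b\<close>] by blast
    have "(J has_real_derivative 1 / g y) (at y within {c..d})"
      using integral_has_real_derivative[OF contg[OF d(2)], of y] that d
      by (simp add: J_def[abs_def])
    then show ?thesis using at_within_interior[of y "{c..d}"] that d by simp
  qed
  have J_cont: "continuous_on {c..d} J" if "d < b" for d
    unfolding J_def
    by (rule indefinite_integral_continuous_1[OF integrable_continuous_interval[OF contg[OF that]]])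
  have J_c: "J c = 0" by (simp add: J_def)
  have J_strict: "J x < J y" if "c \<le> x" "x < y" "y < b" for x y
  proof (rule DERIV_pos_imp_increasing_open[OF \<open>x < y\<close>])
    show "\<exists>D. (J has_real_derivative D) (at z) \<and> 0 < D" if "x < z" "z < y" for z
      using J_der[of z] pos[of z] that \<open>c \<le> x\<close> \<open>y < b\<close> c by (intro exI[of _ "1 / g z"]) auto
    show "continuous_on {x..y} J"
      using J_cont[OF \<open>y < b\<close>] \<open>c \<le> x\<close> by (rule_tac continuous_on_subset) auto
  qed
  \<comment> \<open>The linear bound on \<open>g\<close> makes \<open>J\<close> grow at least like a logarithm at \<open>b\<close>.\<close>
  have J_unbounded: "\<exists>y. c < y \<and> y < b \<and> u < J y" for u
  proof -
    define G where "G y = J y + ln (b - y) / L" for y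
    have G: "G y0 \<le> G y" if "y0 \<le> y" "y < b" for y
    proof (rule DERIV_nonneg_imp_nondecreasing[OF \<open>y0 \<le> y\<close>])
      fix z assume z: "y0 \<le> z" "z \<le> y"
      then have zc: "c < z" "z < b" "a < z" using c that by auto
      have "(G has_real_derivative 1 / g z - 1 / (L * (b - z))) (at z)"
      proof -
        have "((\<lambda>y. ln (b - y)) has_real_derivative - (1 / (b - z))) (at z)"
          using zc by (auto intro!: derivative_eq_intros)
        from DERIV_add[OF J_der[OF zc(1,2)] DERIV_cdivide[OF this, of L]]
        show ?thesis by (simp add: G_def[abs_def] mult.commute)
      qed
      moreover have "1 / (L * (b - z)) \<le> 1 / g z"
        using lin[of z] pos[of z] zc by (intro divide_left_mono) (auto intro!: mult_pos_pos \<open>L > 0\<close>)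
      ultimately show "\<exists>D. (G has_real_derivative D) (at z) \<and> 0 \<le> D" by force
    qed
    define w where "w = min (b - y0) (exp (- L * (u + 1 - G y0)))"
    define y where "y = b - w"
    have w: "0 < w" "w \<le> b - y0" using y0 by (auto simp: w_def)
    have "ln w \<le> ln (exp (- L * (u + 1 - G y0)))"
      using w by (subst ln_le_cancel_iff) (auto simp: w_def)
    then have "ln w / L \<le> - (u + 1 - G y0)"
      using \<open>L > 0\<close> by (simp add: field_simps)
    moreover have "G y0 \<le> J y + ln w / L"
      using G[of y] w by (simp add: y_def G_def)
    ultimately have "u < J y" by simp
    moreover have "c < y" "y < b" using w c by (auto simp: y_def)
    ultimately show ?thesis by blast
  qed
  have surj: "\<exists>y. c < y \<and> y < b \<and> J y = u" if u: "0 < u" for u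
  proof -
    obtain d where d: "c < d" "d < b" "u < J d" using J_unbounded by blast
    have "\<exists>x\<ge>c. x \<le> d \<and> J x = u"
      using IVT'[of J c u d] J_cont[OF d(2)] d u J_c by auto
    then obtain x where "c \<le> x" "x \<le> d" "J x = u" by blast
    moreover from this have "x \<noteq> c" using J_c u by auto
    ultimately show ?thesis using d(2) by (intro exI[of _ x]) simp
  qed
  then obtain Y where Y: "\<And>u. 0 < u \<Longrightarrow> c < Y u \<and> Y u < b \<and> J (Y u) = u" by metis
  have inj: "x = y" if "c \<le> x" "x < b" "c \<le> y" "y < b" "J x = J y" for x y
    using J_strict[of x y] J_strict[of y x] that by (cases x y rule: linorder_cases) auto
  have YJ: "Y (J y) = y" if "c < y" "y < b" for y
    proof -
    have "0 < J y" using J_strict[of c y] J_c that by simp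
    from Y[OF this] show ?thesis using inj[of "Y (J y)" y] that by simp
  qed
  have Y_cont: "isCont Y u" if "0 < u" for u
  proof -
    define x where "x = Y u"
    have x: "c < x" "x < b" "J x = u" using Y[OF that] by (auto simp: x_def)
    obtain p q where pq: "c < p" "p < x" "x < q" "q < b"
      using dense[OF x(1)] dense[OF x(2)] by blast
    have "isCont Y (J x)"
      by (rule isCont_inverse_function2[of p x q Y J])
        (use pq x in \<open>auto intro!: YJ DERIV_isCont[OF J_der]\<close>)
    then show ?thesis using x by simp
  qed
  have Y_der: "(Y has_real_derivative g (Y u)) (at u)" if "0 < u" for u
  proof -
    have gY: "0 < g (Y u)" using Y[OF that] c pos by force
    have "(Y has_real_derivative inverse (1 / g (Y u))) (at u)"
      by (rule DERIV_inverse_function[where f = J and a = 0 and b = "u + 1"])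
        (use Y that gY Y_cont J_der in \<open>auto\<close>)
    then show ?thesis by simp
  qed
  define u0 where "u0 = J y0"
  have u0: "0 < u0" using J_strict[of c y0] J_c c y0 by (simp add: u0_def)
  show thesis
  proof (rule that[of "\<lambda>s. Y (u0 + s)"])
    show "Y (u0 + 0) = y0" using YJ[of y0] c y0 by (simp add: u0_def)
    show "a < Y (u0 + s) \<and> Y (u0 + s) < b" if "0 \<le> s" for s
      using Y[of "u0 + s"] u0 that c by auto
    show "((\<lambda>s. Y (u0 + s)) has_real_derivative g (Y (u0 + s))) (at s)" if "0 \<le> s" for s
      using Y_der[of "u0 + s"] u0 that DERIV_shift[of Y _ s u0] by (simp add: add.commute)
  qed
qed

text \<open>The barrier argument for invariance: a function that at \<open>s\<close> exceeds all its earlier values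
  cannot have a negative derivative there.\<close>

lemma first_hit_derivative_nonneg:
  fixes h :: "real \<Rightarrow> real"
  assumes "(h has_real_derivative D) (at s within {0..<T})" "0 < s" "s < T"
    and "\<And>t. 0 \<le> t \<Longrightarrow> t < s \<Longrightarrow> h t < h s"
  shows "0 \<le> D"
proof (rule ccontr)
  assume "\<not> 0 \<le> D"
  then obtain d where d: "0 < d" "\<And>e. 0 < e \<Longrightarrow> s - e \<in> {0..<T} \<Longrightarrow> e < d \<Longrightarrow> h s < h (s - e)"
    using has_real_derivative_neg_dec_left[OF assms(1)] by auto
  define e where "e = min (d / 2) s"
  have "0 < e" "e \<le> s" "e < d" using d(1) assms(2) by (auto simp: e_def)
  then show False using d(2)[of e] assms(3) assms(4)[of "s - e"] by simp
qed

section \<open>The flow near an attracting node in logarithmic coordinates\<close>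

text \<open>The profile \<open>f\<close> stands for \<open>\<psi>\<close> near a zero with negative slope, shifted to \<open>0\<close> and divided by
  the absolute value of that slope. Its derivative is continuous at the node but in general not
  Lipschitz there, because \<open>\<psi>''\<close> blows up at the zeros of \<open>\<psi>\<close>.\<close>

locale attracting_profile =
  fixes lam \<alpha> :: real and f f' :: "real \<Rightarrow> real"
  assumes lam: "1 < lam" "lam < 2" and \<alpha>: "\<alpha> = 2 - lam"
    and f_der: "\<And>\<tau>. (f has_real_derivative f' \<tau>) (at \<tau>)"
    and f_0: "f 0 = 0" and f'_0: "f' 0 = -1" and f'_cont: "isCont f' 0"
begin

lemma \<alpha>_pos: "0 < \<alpha>"
  using lam \<alpha> by simp

text \<open>The velocity of \<open>w = Ln (\<xi> / p)\<close>, whose real and imaginary parts are the logarithm of the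
  normalised radius and the angle to the ray through \<open>p\<close>.\<close>

definition log_field :: "complex \<Rightarrow> complex" where
  "log_field w = Complex ((- f' (Im w) * exp (- \<alpha> * Re w) - 1) / \<alpha>)
     (lam / \<alpha> * f (Im w) * exp (- \<alpha> * Re w))"

text \<open>The bounds on \<open>- f'\<close> say that on the vertical sides \<open>Re w = \<plusminus> \<kappa>\<close> of the box the field points
  strictly inwards. They also keep \<open>- f'\<close> positive, so that \<open>f\<close> has the sign opposite to \<open>\<tau>\<close> and
  the same holds on the horizontal sides. The bound \<open>\<eta> < pi\<close> keeps the box inside the strip on
  which \<open>Ln\<close> inverts \<open>exp\<close>.\<close>

definition trapping :: "real \<Rightarrow> real \<Rightarrow> bool" where
  "trapping \<kappa> \<eta> \<longleftrightarrow> 0 < \<kappa> \<and> 0 < \<eta> \<and> \<eta> < pi \<and>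
     (\<forall>\<tau>. \<bar>\<tau>\<bar> \<le> \<eta> \<longrightarrow> exp (- \<alpha> * \<kappa>) < - f' \<tau> \<and> - f' \<tau> < exp (\<alpha> * \<kappa>))"

lemma trapping_exists:
  assumes "0 < \<epsilon>"
  obtains \<kappa> \<eta> where "trapping \<kappa> \<eta>" "\<kappa> < \<epsilon>" "\<eta> < \<epsilon>"
proof -
  define \<kappa> where "\<kappa> = \<epsilon> / 2"
  have \<kappa>: "0 < \<kappa>" "\<kappa> < \<epsilon>" using assms by (auto simp: \<kappa>_def)
  have lim: "((\<lambda>\<tau>. - f' \<tau>) \<longlongrightarrow> 1) (nhds 0)"
    using tendsto_minus[OF f'_cont[unfolded continuous_at tendsto_at_iff_tendsto_nhds]]
    by (simp add: f'_0)
  have "\<forall>\<^sub>F \<tau> in nhds 0. exp (- \<alpha> * \<kappa>) < - f' \<tau> \<and> - f' \<tau> < exp (\<alpha> * \<kappa>)"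
    using order_tendstoD[OF lim] \<alpha>_pos \<kappa>(1) by (intro eventually_conj) auto
  then obtain d where d: "0 < d"
    "\<And>\<tau>. \<bar>\<tau>\<bar> < d \<Longrightarrow> exp (- \<alpha> * \<kappa>) < - f' \<tau> \<and> - f' \<tau> < exp (\<alpha> * \<kappa>)"
    by (auto simp: eventually_nhds_metric dist_real_def)
  define \<eta> where "\<eta> = min (d / 2) (min (\<epsilon> / 2) 1)"
  have "0 < \<eta>" "\<eta> < d" "\<eta> < \<epsilon>" "\<eta> < pi"
    using d(1) assms pi_gt3 by (auto simp: \<eta>_def)
  then show thesis using that[of \<kappa> \<eta>] \<kappa> d(2) by (auto simp: trapping_def)
qed

text \<open>The mean value theorem turns the bounds on \<open>f'\<close> into two-sided linear bounds on \<open>f\<close>.\<close>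

lemma trapping_slope:
  assumes "trapping \<kappa> \<eta>" "\<bar>\<tau>\<bar> \<le> \<eta>"
  obtains c where "exp (- \<alpha> * \<kappa>) < c" "c < exp (\<alpha> * \<kappa>)" "f \<tau> = - c * \<tau>"
proof (cases "\<tau> = 0")
  case True
  have "exp (- \<alpha> * \<kappa>) < exp (\<alpha> * \<kappa>)"
    using assms(1) \<alpha>_pos by (auto simp: trapping_def)
  then obtain c where "exp (- \<alpha> * \<kappa>) < c" "c < exp (\<alpha> * \<kappa>)" using dense by blast
  with True show thesis using that f_0 by simp
next
  case False
  have "\<exists>z. \<bar>z\<bar> \<le> \<bar>\<tau>\<bar> \<and> f \<tau> = f' z * \<tau>"
  proof (cases "0 < \<tau>")
    case True
    from MVT2[OF this, of f f'] f_der obtain z where "0 < z" "z < \<tau>" "f \<tau> - f 0 = (\<tau> - 0) * f' z"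
      by blast
    then show ?thesis using f_0 by (intro exI[of _ z]) (auto simp: mult.commute)
  next
    case neg: False
    with False have "\<tau> < 0" by simp
    from MVT2[OF this, of f f'] f_der obtain z where "\<tau> < z" "z < 0" "f 0 - f \<tau> = (0 - \<tau>) * f' z"
      by blast
    then show ?thesis using f_0 by (intro exI[of _ z]) (auto simp: algebra_simps)
  qed
  then obtain z where "\<bar>z\<bar> \<le> \<eta>" "f \<tau> = f' z * \<tau>" using assms(2) order_trans by blast
  then show thesis using that[of "- f' z"] assms(1) by (auto simp: trapping_def)
qed

text \<open>Reflecting the plane in the ray through \<open>p\<close> reduces the side \<open>\<tau> > 0\<close> to the side \<open>\<tau> < 0\<close>.\<close>

lemma mirror: "attracting_profile lam \<alpha> (\<lambda>\<tau>. - f (- \<tau>)) (\<lambda>\<tau>. f' (- \<tau>))"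
proof
  show "((\<lambda>\<tau>. - f (- \<tau>)) has_real_derivative f' (- \<tau>)) (at \<tau>)" for \<tau>
    by (auto intro!: derivative_eq_intros DERIV_chain2[OF f_der])
  have "isCont (\<lambda>\<tau>. f' (- \<tau>)) 0"
    using f'_cont by (intro isCont_o2[of _ uminus f'] continuous_intros) simp
  then show "isCont (\<lambda>\<tau>. f' (- \<tau>)) 0" .
qed (use lam \<alpha> f_0 f'_0 in auto)

text \<open>Integration by quadrature. Constancy of \<open>K = q * exp t * f \<tau> powr (\<alpha> / lam)\<close> gives \<open>q\<close> in terms
  of \<open>\<tau>\<close>, and then \<open>\<tau>' = (lam / (\<alpha> * K)) * exp t * f \<tau> powr (2 / lam)\<close>, because
  \<open>1 + \<alpha> / lam = 2 / lam\<close>. In the time \<open>s t = (lam / (\<alpha> * K)) * (exp t - 1)\<close> this equation is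
  autonomous. Its right-hand side is at most linear at the equilibrium \<open>0\<close>, since \<open>f\<close> is and
  \<open>2 / lam \<ge> 1\<close>.\<close>

lemma solution_exists_left:
  assumes trap: "trapping \<kappa> \<eta>" and \<tau>0: "- \<eta> < \<tau>0" "\<tau>0 < 0" and "0 < q0"
  shows "\<exists>q \<tau>. q 0 = q0 \<and> \<tau> 0 = \<tau>0 \<and> (\<forall>t\<ge>0. 0 < q t \<and>
    (q has_real_derivative - f' (\<tau> t) - q t) (at t) \<and>
    (\<tau> has_real_derivative lam / \<alpha> * f (\<tau> t) / q t) (at t))"
proof -
  have f_pos: "0 < f \<tau>" and f_le: "f \<tau> \<le> exp (\<alpha> * \<kappa>) * (- \<tau>)" if \<tau>: "- \<eta> < \<tau>" "\<tau> < 0" for \<tau>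
  proof -
    obtain c where c: "exp (- \<alpha> * \<kappa>) < c" "c < exp (\<alpha> * \<kappa>)" "f \<tau> = - c * \<tau>"
      by (rule trapping_slope[OF trap, of \<tau>]) (use \<tau> in auto)
    have "0 < c" using c(1) exp_gt_zero[of "- \<alpha> * \<kappa>"] by linarith
    then show "0 < f \<tau>" using c(3) \<tau> by (simp add: mult_pos_neg)
    show "f \<tau> \<le> exp (\<alpha> * \<kappa>) * (- \<tau>)" using c \<tau> by (simp add: mult_right_mono_neg)
  qed
  define M where "M = exp (\<alpha> * \<kappa>) * \<eta>"
  have two_lam: "2 / lam = 1 + \<alpha> / lam" using lam \<alpha> by (simp add: field_simps)
  obtain y where y: "y 0 = \<tau>0" "\<And>s. 0 \<le> s \<Longrightarrow> - \<eta> < y s \<and> y s < 0"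
    "\<And>s. 0 \<le> s \<Longrightarrow> (y has_real_derivative f (y s) powr (2 / lam)) (at s)"
  proof (rule scalar_flow_towards_equilibrium
      [of "- \<eta>" 0 "\<lambda>\<tau>. f \<tau> powr (2 / lam)" "M powr (\<alpha> / lam) * exp (\<alpha> * \<kappa>)" \<tau>0])
    have "continuous_on {- \<eta><..<0} f"
      by (meson DERIV_isCont continuous_at_imp_continuous_on f_der)
    then show "continuous_on {- \<eta><..<0} (\<lambda>\<tau>. f \<tau> powr (2 / lam))"
      using f_pos by (intro continuous_intros) (auto simp: less_imp_neq[symmetric])
    fix \<tau> assume \<tau>: "- \<eta> < \<tau>" "\<tau> < 0"
    show "0 < f \<tau> powr (2 / lam)" using f_pos[OF \<tau>] by simp
    have "f \<tau> \<le> M"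
      using f_le[OF \<tau>] mult_left_mono[of "- \<tau>" \<eta> "exp (\<alpha> * \<kappa>)"] \<tau> by (simp add: M_def)
    then have "f \<tau> powr (\<alpha> / lam) \<le> M powr (\<alpha> / lam)"
      using f_pos[OF \<tau>] \<alpha>_pos lam by (intro powr_mono2) auto
    then have "f \<tau> powr (\<alpha> / lam) * f \<tau> \<le> M powr (\<alpha> / lam) * (exp (\<alpha> * \<kappa>) * (- \<tau>))"
      using f_le[OF \<tau>] f_pos[OF \<tau>] by (intro mult_mono) auto
    then show "f \<tau> powr (2 / lam) \<le> M powr (\<alpha> / lam) * exp (\<alpha> * \<kappa>) * (0 - \<tau>)"
      using f_pos[OF \<tau>] by (simp add: two_lam powr_add mult_ac)
  qed (use \<tau>0 in auto)
  \<comment> \<open>\<open>K\<close> is the value of the first integral \<open>q * exp t * f \<tau> powr (\<alpha> / lam)\<close>.\<close>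
  define K where "K = q0 * f \<tau>0 powr (\<alpha> / lam)"
  have K: "0 < K" using f_pos[of \<tau>0] \<tau>0 \<open>0 < q0\<close> by (simp add: K_def)
  define s where "s t = lam / (\<alpha> * K) * (exp t - 1)" for t :: real
  define \<tau> where "\<tau> t = y (s t)" for t
  define q where "q t = K * (exp (- t) * f (\<tau> t) powr (- \<alpha> / lam))" for t
  have s_nonneg: "0 \<le> s t" if "0 \<le> t" for t
    using that K \<alpha>_pos lam by (simp add: s_def)
  have s_der: "(s has_real_derivative lam / (\<alpha> * K) * exp t) (at t)" for t
    unfolding s_def using K \<alpha>_pos by (auto intro!: derivative_eq_intros)
  show ?thesis
  proof (rule exI[of _ q], rule exI[of _ \<tau>], intro conjI allI impI)
    show "\<tau> 0 = \<tau>0" using y(1) by (simp add: \<tau>_def s_def)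
    then show "q 0 = q0"
      using f_pos[of \<tau>0] \<tau>0 by (simp add: q_def K_def powr_minus field_simps)
    fix t :: real assume t: "0 \<le> t"
    have \<tau>: "- \<eta> < \<tau> t" "\<tau> t < 0" using y(2)[OF s_nonneg[OF t]] by (auto simp: \<tau>_def)
    note fp = f_pos[OF \<tau>]
    show "0 < q t" using K fp by (simp add: q_def)
    define \<tau>' where "\<tau>' = f (\<tau> t) powr (2 / lam) * (lam / (\<alpha> * K) * exp t)"
    have \<tau>_der: "(\<tau> has_real_derivative \<tau>') (at t)"
      unfolding \<tau>_def \<tau>'_def by (rule DERIV_chain2[OF y(3)[OF s_nonneg[OF t]] s_der])
    have "\<tau>' = lam / \<alpha> * f (\<tau> t) / q t"
      using K fp by (simp add: \<tau>'_def q_def two_lam powr_add powr_minus exp_minus field_simps)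
    with \<tau>_der show "(\<tau> has_real_derivative lam / \<alpha> * f (\<tau> t) / q t) (at t)" by simp
    have f_der: "((\<lambda>t. f (\<tau> t)) has_real_derivative f' (\<tau> t) * \<tau>') (at t)"
      by (rule DERIV_chain2[OF f_der \<tau>_der])
    note powr_der = DERIV_chain2[OF has_real_derivative_powr[OF fp, of "- \<alpha> / lam"] f_der]
    have exp_der: "((\<lambda>t. exp (- t)) has_real_derivative - exp (- t)) (at t)"
      by (auto intro!: derivative_eq_intros)
    have "(q has_real_derivative K * (- exp (- t) * f (\<tau> t) powr (- \<alpha> / lam) +
        - \<alpha> / lam * f (\<tau> t) powr (- \<alpha> / lam - 1) * (f' (\<tau> t) * \<tau>') * exp (- t))) (at t)"
      unfolding q_def by (rule DERIV_cmult[OF DERIV_mult[OF exp_der powr_der]])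
    moreover have "f (\<tau> t) powr (- \<alpha> / lam - 1) * f (\<tau> t) powr (2 / lam) = 1"
      using fp by (simp add: powr_add[symmetric] two_lam)
    then have "K * (- \<alpha> / lam * f (\<tau> t) powr (- \<alpha> / lam - 1) * (f' (\<tau> t) * \<tau>') * exp (- t)) = - f' (\<tau> t)"
      using K \<alpha>_pos lam by (simp add: \<tau>'_def exp_minus field_simps)
    then have "K * (- exp (- t) * f (\<tau> t) powr (- \<alpha> / lam) +
        - \<alpha> / lam * f (\<tau> t) powr (- \<alpha> / lam - 1) * (f' (\<tau> t) * \<tau>') * exp (- t)) = - f' (\<tau> t) - q t"
      unfolding distrib_left by (simp add: q_def)
    ultimately show "(q has_real_derivative - f' (\<tau> t) - q t) (at t)" by simp
  qed
qed

text \<open>On the ray \<open>\<tau> = 0\<close> itself the first integral degenerates, but there \<open>q' = 1 - q\<close>.\<close>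

lemma solution_exists:
  assumes trap: "trapping \<kappa> \<eta>" and \<tau>0: "\<bar>\<tau>0\<bar> < \<eta>" and q0: "0 < q0"
  shows "\<exists>q \<tau>. q 0 = q0 \<and> \<tau> 0 = \<tau>0 \<and> (\<forall>t\<ge>0. 0 < q t \<and>
    (q has_real_derivative - f' (\<tau> t) - q t) (at t) \<and>
    (\<tau> has_real_derivative lam / \<alpha> * f (\<tau> t) / q t) (at t))"
proof (cases \<tau>0 "0 :: real" rule: linorder_cases)
  case less
  then show ?thesis using solution_exists_left[OF trap _ _ q0] \<tau>0 by auto
next
  case equal
  define q where "q t = 1 + (q0 - 1) * exp (- t)" for t :: real
  have "0 < q t" if "0 \<le> t" for t
  proof -
    have "q t = (1 - exp (- t)) + q0 * exp (- t)" by (simp add: q_def algebra_simps)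
    moreover have "0 < q0 * exp (- t)" using q0 by simp
    moreover have "exp (- t) \<le> 1" using that by simp
    ultimately show ?thesis by linarith
  qed
  moreover have "(q has_real_derivative - f' 0 - q t) (at t)" for t
    unfolding q_def by (auto intro!: derivative_eq_intros simp: f'_0)
  ultimately show ?thesis
    by (intro exI[of _ q] exI[of _ "\<lambda>_. 0"]) (auto simp: equal f_0 q_def)
next
  case greater
  interpret mirror: attracting_profile lam \<alpha> "\<lambda>\<tau>. - f (- \<tau>)" "\<lambda>\<tau>. f' (- \<tau>)"
    by (rule mirror)
  have "mirror.trapping \<kappa> \<eta>"
    using trap unfolding mirror.trapping_def trapping_def by (metis abs_minus_cancel)
  from mirror.solution_exists_left[OF this, of "- \<tau>0" q0] greater \<tau>0 q0
  obtain q \<tau> where q: "q 0 = q0" "\<tau> 0 = - \<tau>0" "\<And>t. 0 \<le> t \<Longrightarrow> 0 < q t"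
    "\<And>t. 0 \<le> t \<Longrightarrow> (q has_real_derivative - f' (- \<tau> t) - q t) (at t)"
    "\<And>t. 0 \<le> t \<Longrightarrow> (\<tau> has_real_derivative lam / \<alpha> * - f (- \<tau> t) / q t) (at t)"
    by auto
  have "((\<lambda>t. - \<tau> t) has_real_derivative lam / \<alpha> * f (- \<tau> t) / q t) (at t)" if "0 \<le> t" for t
    using DERIV_minus[OF q(5)[OF that]] by simp
  then show ?thesis using q(1-4) by (intro exI[of _ q] exI[of _ "\<lambda>t. - \<tau> t"]) auto
qed

text \<open>The solution \<open>(q, \<tau>)\<close> in the coordinate \<open>w = ln q / \<alpha> + \<i> * \<tau>\<close>.\<close>

lemma log_solution_exists:
  assumes "trapping \<kappa> \<eta>" "\<bar>Im w0\<bar> < \<eta>"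
  obtains w where "w 0 = w0"
    "\<And>t. 0 \<le> t \<Longrightarrow> (w has_vector_derivative log_field (w t)) (at t)"
proof -
  obtain q \<tau> where q: "q 0 = exp (\<alpha> * Re w0)" "\<tau> 0 = Im w0"
    "\<And>t. 0 \<le> t \<Longrightarrow> 0 < q t"
    "\<And>t. 0 \<le> t \<Longrightarrow> (q has_real_derivative - f' (\<tau> t) - q t) (at t)"
    "\<And>t. 0 \<le> t \<Longrightarrow> (\<tau> has_real_derivative lam / \<alpha> * f (\<tau> t) / q t) (at t)"
    using solution_exists[OF assms, of "exp (\<alpha> * Re w0)"] by auto
  define w where "w t = Complex (ln (q t) / \<alpha>) (\<tau> t)" for t
  show thesis
  proof (rule that[of w])
    show "w 0 = w0" using q(1,2) \<alpha>_pos by (simp add: w_def complex_eq_iff)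
    fix t :: real assume t: "0 \<le> t"
    have e: "exp (- \<alpha> * Re (w t)) = 1 / q t"
      using q(3)[OF t] \<alpha>_pos by (simp add: w_def exp_minus field_simps)
    have "((\<lambda>t. ln (q t) / \<alpha>) has_real_derivative (1 / q t * (- f' (\<tau> t) - q t)) / \<alpha>) (at t)"
      by (rule DERIV_cdivide[OF DERIV_chain2[OF DERIV_ln_divide[OF q(3)[OF t]] q(4)[OF t]]])
    moreover have "(1 / q t * (- f' (\<tau> t) - q t)) / \<alpha> = Re (log_field (w t))"
      using q(3)[OF t] unfolding log_field_def e by (simp add: w_def diff_divide_distrib)
    moreover have "lam / \<alpha> * f (\<tau> t) / q t = Im (log_field (w t))"
      unfolding log_field_def e by (simp add: w_def)
    ultimately show "(w has_vector_derivative log_field (w t)) (at t)"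
      using q(5)[OF t] unfolding has_vector_derivative_complex_iff by (simp add: w_def)
  qed
qed

end

lemma trajectory_on_subset: "trajectory_on F x I \<Longrightarrow> J \<subseteq> I \<Longrightarrow> trajectory_on F x J"
  unfolding trajectory_on_def by (meson has_vector_derivative_within_subset subset_iff)

text \<open>A field \<open>F\<close> that is \<^term>\<open>log_field\<close> in the coordinate \<open>w\<close> given by \<open>\<xi> = p * exp w\<close>.\<close>

locale log_coordinate = attracting_profile +
  fixes F :: "complex \<Rightarrow> complex" and p :: complex
  assumes p_nz: "p \<noteq> 0"
    and F_exp: "\<And>w. F (p * exp w) = p * exp w * log_field w"
begin

definition box_image :: "real \<Rightarrow> real \<Rightarrow> complex set" where
  "box_image \<kappa> \<eta> = (\<lambda>w. p * exp w) ` {w. \<bar>Re w\<bar> < \<kappa> \<and> \<bar>Im w\<bar> < \<eta>}"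

lemma exp_not_nonpos:
  assumes "\<bar>Im w\<bar> < pi"
  shows "Ln (exp w) = w" "exp w \<notin> \<real>\<^sub>\<le>\<^sub>0"
proof -
  show *: "Ln (exp w) = w" using assms by simp
  show "exp w \<notin> \<real>\<^sub>\<le>\<^sub>0"
    using Im_Ln_eq_pi[of "exp w"] assms unfolding * complex_nonpos_Reals_iff
    by (metis abs_of_pos complex_eq_iff exp_not_eq_zero less_irrefl order_le_less pi_gt_zero
        zero_complex.sel)
qed

lemma open_box_image:
  assumes "\<eta> < pi"
  shows "open (box_image \<kappa> \<eta>)"
proof -
  define B where "B = {w. \<bar>Re w\<bar> < \<kappa> \<and> \<bar>Im w\<bar> < \<eta>}"
  have "open B" unfolding B_def
    by (intro open_Collect_conj open_Collect_less continuous_intros)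
  moreover have "continuous_on (- \<real>\<^sub>\<le>\<^sub>0) Ln" by (intro continuous_on_Ln) auto
  ultimately have "open (- \<real>\<^sub>\<le>\<^sub>0 \<inter> Ln -` B)"
    by (intro continuous_open_preimage) (auto simp: open_Compl)
  then have "open ((\<lambda>x. x / p) -` (- \<real>\<^sub>\<le>\<^sub>0 \<inter> Ln -` B))"
    by (intro open_vimage continuous_intros) (auto simp: p_nz)
  also have "(\<lambda>x. x / p) -` (- \<real>\<^sub>\<le>\<^sub>0 \<inter> Ln -` B) = box_image \<kappa> \<eta>"
  proof (intro set_eqI iffI)
    fix x assume x: "x \<in> (\<lambda>x. x / p) -` (- \<real>\<^sub>\<le>\<^sub>0 \<inter> Ln -` B)"
    then have "x / p \<noteq> 0" by auto
    then have "x = p * exp (Ln (x / p))" using p_nz by simp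
    moreover have "Ln (x / p) \<in> B" using x by simp
    ultimately show "x \<in> box_image \<kappa> \<eta>" unfolding box_image_def B_def by blast
  next
    fix x assume "x \<in> box_image \<kappa> \<eta>"
    then obtain w where "x = p * exp w" "w \<in> B" by (auto simp: box_image_def B_def)
    then show "x \<in> (\<lambda>x. x / p) -` (- \<real>\<^sub>\<le>\<^sub>0 \<inter> Ln -` B)"
      using exp_not_nonpos[of w] assms p_nz by (auto simp: B_def)
  qed
  finally show ?thesis .
qed

lemma box_image_neighbourhood:
  assumes "trapping \<kappa> \<eta>"
  obtains \<delta> where "0 < \<delta>" "ball p \<delta> \<subseteq> box_image \<kappa> \<eta>"
proof -
  have "p \<in> box_image \<kappa> \<eta>"
    using assms by (auto simp: box_image_def trapping_def intro!: image_eqI[of _ _ 0])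
  then show thesis
    using open_box_image[of \<eta> \<kappa>] assms that by (auto simp: trapping_def open_contains_ball)
qed

lemma small_box_image:
  assumes "0 < \<epsilon>"
  obtains \<kappa> \<eta> where "trapping \<kappa> \<eta>" "box_image \<kappa> \<eta> \<subseteq> ball p \<epsilon>"
proof -
  have "isCont (\<lambda>w. p * exp w) 0" by (intro continuous_intros)
  then obtain d where d: "0 < d" "\<And>w. dist w 0 < d \<Longrightarrow> dist (p * exp w) (p * exp 0) < \<epsilon>"
    using assms unfolding continuous_at_eps_delta by blast
  obtain \<kappa> \<eta> where \<kappa>: "trapping \<kappa> \<eta>" "\<kappa> < d / 2" "\<eta> < d / 2"
    using trapping_exists[of "d / 2"] d(1) by auto
  have "cmod w < d" if "\<bar>Re w\<bar> < \<kappa>" "\<bar>Im w\<bar> < \<eta>" for w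
    using cmod_le[of w] that \<kappa> by simp
  then have "box_image \<kappa> \<eta> \<subseteq> ball p \<epsilon>"
    using d(2) by (auto simp: box_image_def dist_commute)
  with \<kappa>(1) show thesis using that by blast
qed

lemma trajectory_in_log_coordinate:
  assumes "trajectory_on F x I" "s \<in> I" "x s = p * exp w" "\<bar>Im w\<bar> < pi"
  shows "((\<lambda>t. Re (Ln (x t / p))) has_real_derivative Re (log_field w)) (at s within I)"
    and "((\<lambda>t. Im (Ln (x t / p))) has_real_derivative Im (log_field w)) (at s within I)"
proof -
  have "(x has_vector_derivative p * exp w * log_field w) (at s within I)"
    using assms(1-3) F_exp[of w] by (auto simp: trajectory_on_def)
  from bounded_linear.has_vector_derivative[OF bounded_linear_divide[of p] this]
  have x: "((\<lambda>t. x t / p) has_vector_derivative exp w * log_field w) (at s within I)"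
    using p_nz by simp
  have xs: "x s / p = exp w" using assms(3) p_nz by simp
  have "(Ln has_field_derivative inverse (x s / p)) (at (x s / p) within (\<lambda>t. x t / p) ` I)"
    unfolding xs by (rule has_field_derivative_at_within[OF has_field_derivative_Ln])
      (use exp_not_nonpos[OF assms(4)] in auto)
  from field_vector_diff_chain_within[OF x this]
  have "((\<lambda>t. Ln (x t / p)) has_vector_derivative log_field w) (at s within I)"
    by (simp add: o_def xs field_simps)
  then show "((\<lambda>t. Re (Ln (x t / p))) has_real_derivative Re (log_field w)) (at s within I)"
    and "((\<lambda>t. Im (Ln (x t / p))) has_real_derivative Im (log_field w)) (at s within I)"
    by (auto simp: has_vector_derivative_complex_iff)
qed

text \<open>At the first exit time the point would lie on one of the four sides of the box, where the
  corresponding coordinate cannot move outwards.\<close>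

lemma box_image_invariant:
  assumes trap: "trapping \<kappa> \<eta>" and traj: "trajectory_on F x {0..<T}"
    and x0: "x 0 \<in> box_image \<kappa> \<eta>" and t1: "0 \<le> t1" "t1 < T"
  shows "x t1 \<in> box_image \<kappa> \<eta>"
proof (rule ccontr)
  assume out: "x t1 \<notin> box_image \<kappa> \<eta>"
  have pos: "0 < \<kappa>" "0 < \<eta>" "\<eta> < pi" using trap by (auto simp: trapping_def)
  have cont: "continuous_on {0..<T} x"
    using traj unfolding trajectory_on_def continuous_on_eq_continuous_within
    by (auto intro: has_vector_derivative_continuous)
  define A where "A = {0..t1} \<inter> x -` (- box_image \<kappa> \<eta>)"
  have "closed A"
    unfolding A_def using t1 open_box_image[OF pos(3)]
    by (intro continuous_closed_preimage continuous_on_subset[OF cont]) (auto simp: closed_def)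
  then have "compact A"
    using compact_Int_closed[of "{0..t1}" A] by (simp add: A_def Int_absorb1)
  moreover have "t1 \<in> A" using out t1 by (simp add: A_def)
  ultimately obtain s where s: "s \<in> A" "\<And>t. t \<in> A \<Longrightarrow> s \<le> t"
    using compact_attains_inf[of A] by blast
  have s_out: "x s \<notin> box_image \<kappa> \<eta>" "0 \<le> s" "s \<le> t1" using s(1) by (auto simp: A_def)
  with x0 have "0 < s" by (cases "s = 0") auto
  have "s < T" using s_out t1 by simp
  have before: "x t \<in> box_image \<kappa> \<eta>" if "0 \<le> t" "t < s" for t
    using s(2)[of t] that s_out by (auto simp: A_def)
  define K where "K = (\<lambda>w. p * exp w) ` cbox (Complex (- \<kappa>) (- \<eta>)) (Complex \<kappa> \<eta>)"
  \<comment> \<open>The closed box has a compact image, so the first exit point is still represented in it.\<close>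
  have "compact K" unfolding K_def
    by (intro compact_continuous_image continuous_intros compact_cbox)
  have sub: "box_image \<kappa> \<eta> \<subseteq> K"
    unfolding box_image_def K_def by (intro image_mono) (auto simp: in_cbox_complex_iff)
  have "closed ({0..s} \<inter> x -` K)"
    using \<open>compact K\<close> \<open>s < T\<close>
    by (intro continuous_closed_preimage continuous_on_subset[OF cont]) (auto intro: compact_imp_closed)
  moreover have "{0..<s} \<subseteq> {0..s} \<inter> x -` K" using before subsetD[OF sub] by auto
  ultimately have "closure {0..<s} \<subseteq> {0..s} \<inter> x -` K" by (rule closure_minimal[rotated])
  moreover have "s \<in> closure {0..<s}" using \<open>0 < s\<close> by simp
  ultimately have "x s \<in> K" by blast
  then obtain w where "x s = p * exp w" "w \<in> cbox (Complex (- \<kappa>) (- \<eta>)) (Complex \<kappa> \<eta>)"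
    unfolding K_def by blast
  then have w: "x s = p * exp w" "\<bar>Re w\<bar> \<le> \<kappa>" "\<bar>Im w\<bar> \<le> \<eta>"
    by (auto simp: in_cbox_complex_iff)
  have Im_w: "\<bar>Im w\<bar> < pi" using w(3) pos(3) by simp
  define R where "R t = Re (Ln (x t / p))" for t
  define J where "J t = Im (Ln (x t / p))" for t
  have R_der: "(R has_real_derivative Re (log_field w)) (at s within {0..<T})"
    and J_der: "(J has_real_derivative Im (log_field w)) (at s within {0..<T})"
    using trajectory_in_log_coordinate[OF traj _ w(1) Im_w] \<open>0 < s\<close> \<open>s < T\<close>
    by (simp_all add: R_def[abs_def] J_def[abs_def])
  have at_s: "R s = Re w" "J s = Im w"
    using w(1) p_nz exp_not_nonpos(1)[OF Im_w] by (simp_all add: R_def J_def)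
  have inside: "\<bar>R t\<bar> < \<kappa> \<and> \<bar>J t\<bar> < \<eta>" if t: "0 \<le> t" "t < s" for t
  proof -
    obtain v where v: "x t = p * exp v" "\<bar>Re v\<bar> < \<kappa>" "\<bar>Im v\<bar> < \<eta>"
      using before[OF t] by (auto simp: box_image_def)
    have "Ln (x t / p) = v" using v p_nz exp_not_nonpos(1)[of v] pos by simp
    with v show ?thesis by (simp add: R_def J_def)
  qed
  note hit = first_hit_derivative_nonneg[OF _ \<open>0 < s\<close> \<open>s < T\<close>]
  have slope: "exp (- \<alpha> * \<kappa>) < - f' (Im w)" "- f' (Im w) < exp (\<alpha> * \<kappa>)"
    using trap w(3) by (auto simp: trapping_def)
  obtain c where c: "exp (- \<alpha> * \<kappa>) < c" "f (Im w) = - c * Im w"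
    using trapping_slope[OF trap w(3)] by metis
  have c_pos: "0 < c" using c(1) exp_gt_zero[of "- \<alpha> * \<kappa>"] by linarith
  have *: "0 < lam / \<alpha> * c * \<eta> * exp (- \<alpha> * Re w)"
    using lam \<alpha>_pos c_pos pos by simp
  consider "Re w = \<kappa>" | "Re w = - \<kappa>" | "Im w = \<eta>" | "Im w = - \<eta>"
    using w s_out(1) unfolding box_image_def by force
  then show False
  proof cases
    case 1
    have "- f' (Im w) * exp (- (\<alpha> * \<kappa>)) < exp (\<alpha> * \<kappa>) * exp (- (\<alpha> * \<kappa>))"
      using slope(2) by (intro mult_strict_right_mono) auto
    then have "Re (log_field w) < 0"
      using 1 \<alpha>_pos by (simp add: log_field_def exp_add[symmetric] divide_neg_pos)
    moreover have "0 \<le> Re (log_field w)"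
      by (rule hit[OF R_der]) (use inside 1 at_s in force)
    ultimately show False by simp
  next
    case 2
    have "exp (- \<alpha> * \<kappa>) * exp (\<alpha> * \<kappa>) < - f' (Im w) * exp (\<alpha> * \<kappa>)"
      using slope(1) by (intro mult_strict_right_mono) auto
    then have "0 < Re (log_field w)"
      using 2 \<alpha>_pos by (simp add: log_field_def exp_add[symmetric])
    moreover have "0 \<le> - Re (log_field w)"
      by (rule hit[OF DERIV_minus[OF R_der]]) (use inside 2 at_s in force)
    ultimately show False by simp
  next
    case 3
    have "Im (log_field w) < 0" using * 3 c(2) by (simp add: log_field_def)
    moreover have "0 \<le> Im (log_field w)"
      by (rule hit[OF J_der]) (use inside 3 at_s in force)
    ultimately show False by simp
  next
    case 4
    have "0 < Im (log_field w)" using * 4 c(2) by (simp add: log_field_def)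
    moreover have "0 \<le> - Im (log_field w)"
      by (rule hit[OF DERIV_minus[OF J_der]]) (use inside 4 at_s in force)
    ultimately show False by simp
  qed
qed

text \<open>Inside a trapping box \<open>\<tau>\<^sup>2\<close> decays exponentially. Hence \<open>- f' \<tau>\<close> tends to \<open>1\<close>, and
  \<open>(q - 1)\<^sup>2\<close> satisfies a linear differential inequality whose forcing \<open>(- f' \<tau> - 1)\<^sup>2\<close> tends to \<open>0\<close>.\<close>

lemma box_image_attracted:
  assumes trap: "trapping \<kappa> \<eta>" and traj: "trajectory_on F x {0..}"
    and inside: "\<And>t. 0 \<le> t \<Longrightarrow> x t \<in> box_image \<kappa> \<eta>"
  shows "(x \<longlongrightarrow> p) at_top"
proof -
  define \<sigma> where "\<sigma> t = Re (Ln (x t / p))" for t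
  define \<tau> where "\<tau> t = Im (Ln (x t / p))" for t
  have pos: "0 < \<kappa>" "0 < \<eta>" "\<eta> < pi" using trap by (auto simp: trapping_def)
  have x_eq: "x t = p * exp (Complex (\<sigma> t) (\<tau> t))" and \<sigma>: "\<bar>\<sigma> t\<bar> < \<kappa>" and \<tau>: "\<bar>\<tau> t\<bar> < \<eta>"
    if t: "0 \<le> t" for t
  proof -
    obtain v where v: "x t = p * exp v" "\<bar>Re v\<bar> < \<kappa>" "\<bar>Im v\<bar> < \<eta>"
      using inside[OF t] by (auto simp: box_image_def)
    have "Ln (x t / p) = v" using v p_nz exp_not_nonpos(1)[of v] pos by simp
    then show "x t = p * exp (Complex (\<sigma> t) (\<tau> t))" "\<bar>\<sigma> t\<bar> < \<kappa>" "\<bar>\<tau> t\<bar> < \<eta>"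
      using v by (simp_all add: \<sigma>_def \<tau>_def)
  qed
  have \<sigma>_der: "(\<sigma> has_real_derivative (- f' (\<tau> t) * exp (- \<alpha> * \<sigma> t) - 1) / \<alpha>) (at t within {0..})"
    and \<tau>_der: "(\<tau> has_real_derivative lam / \<alpha> * f (\<tau> t) * exp (- \<alpha> * \<sigma> t)) (at t within {0..})"
    if "0 \<le> t" for t
    using trajectory_in_log_coordinate[OF traj _ x_eq[OF that]] \<tau>[OF that] that pos
    by (simp_all add: \<sigma>_def[abs_def] \<tau>_def[abs_def] log_field_def)
  define E where "E = exp (- \<alpha> * \<kappa>)"
  have E: "0 < E" by (simp add: E_def)
  have "((\<lambda>t. (\<tau> t)\<^sup>2) \<longlongrightarrow> 0) at_top"
  proof (rule decay_of_forced_inequality[where c = "2 * (lam / \<alpha>) * E * E" and g = "\<lambda>_. 0"])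
    fix t :: real assume t: "0 \<le> t"
    show "((\<lambda>t. (\<tau> t)\<^sup>2) has_real_derivative 2 * \<tau> t * (lam / \<alpha> * f (\<tau> t) * exp (- \<alpha> * \<sigma> t)))
        (at t within {0..})"
      by (auto intro!: derivative_eq_intros \<tau>_der[OF t])
    obtain c where c: "E < c" "f (\<tau> t) = - c * \<tau> t"
      using trapping_slope[OF trap, of "\<tau> t"] \<tau>[OF t] unfolding E_def by (metis less_imp_le)
    have "E \<le> exp (- \<alpha> * \<sigma> t)"
      using \<sigma>[OF t] \<alpha>_pos by (simp add: E_def)
    then have "E * E \<le> c * exp (- \<alpha> * \<sigma> t)"
      using c(1) E by (intro mult_mono) auto
    then have "(2 * (lam / \<alpha>) * (\<tau> t)\<^sup>2) * (E * E) \<le> (2 * (lam / \<alpha>) * (\<tau> t)\<^sup>2) * (c * exp (- \<alpha> * \<sigma> t))"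
      using lam \<alpha>_pos by (intro mult_left_mono) auto
    then show "2 * \<tau> t * (lam / \<alpha> * f (\<tau> t) * exp (- \<alpha> * \<sigma> t))
        \<le> - (2 * (lam / \<alpha>) * E * E) * (\<tau> t)\<^sup>2 + 0"
      unfolding c(2) by (simp add: power2_eq_square mult_ac)
  qed (use lam \<alpha>_pos E in auto)
  then have "((\<lambda>t. sqrt ((\<tau> t)\<^sup>2)) \<longlongrightarrow> sqrt 0) at_top" by (rule tendsto_real_sqrt)
  then have \<tau>_lim: "(\<tau> \<longlongrightarrow> 0) at_top"
    by (simp add: tendsto_rabs_zero_iff)
  have "((\<lambda>t. f' (\<tau> t)) \<longlongrightarrow> - 1) at_top"
    using isCont_tendsto_compose[OF f'_cont \<tau>_lim] by (simp add: f'_0)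
  then have "((\<lambda>t. (- f' (\<tau> t) - 1)\<^sup>2) \<longlongrightarrow> (- (- 1) - 1)\<^sup>2) at_top"
    by (intro tendsto_intros)
  then have forcing: "((\<lambda>t. (- f' (\<tau> t) - 1)\<^sup>2) \<longlongrightarrow> 0) at_top" by simp
  define q where "q t = exp (\<alpha> * \<sigma> t)" for t
  have q_der: "(q has_real_derivative - f' (\<tau> t) - q t) (at t within {0..})" if "0 \<le> t" for t
  proof -
    have "(q has_real_derivative exp (\<alpha> * \<sigma> t) * (\<alpha> * ((- f' (\<tau> t) * exp (- \<alpha> * \<sigma> t) - 1) / \<alpha>)))
        (at t within {0..})"
      unfolding q_def by (auto intro!: derivative_eq_intros \<sigma>_der[OF that])
    moreover have "exp (\<alpha> * \<sigma> t) * (\<alpha> * ((- f' (\<tau> t) * exp (- \<alpha> * \<sigma> t) - 1) / \<alpha>)) = - f' (\<tau> t) - q t"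
      using \<alpha>_pos by (simp add: q_def exp_minus field_simps)
    ultimately show ?thesis by simp
  qed
  have "((\<lambda>t. (q t - 1)\<^sup>2) \<longlongrightarrow> 0) at_top"
  proof (rule decay_of_forced_inequality[OF _ _ _ _ forcing, where c = 1])
    fix t :: real assume t: "0 \<le> t"
    show "((\<lambda>t. (q t - 1)\<^sup>2) has_real_derivative 2 * (q t - 1) * (- f' (\<tau> t) - q t)) (at t within {0..})"
      by (auto intro!: derivative_eq_intros q_der[OF t])
    \<comment> \<open>With \<open>h = - f' \<tau> - 1\<close> the claim is \<open>2 * (q - 1) * (h - (q - 1)) \<le> - (q - 1)\<^sup>2 + h\<^sup>2\<close>, that is,
      \<open>2 * (q - 1) * h \<le> (q - 1)\<^sup>2 + h\<^sup>2\<close>.\<close>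
    have "0 \<le> ((q t - 1) - (- f' (\<tau> t) - 1))\<^sup>2" by simp
    then show "2 * (q t - 1) * (- f' (\<tau> t) - q t) \<le> - 1 * (q t - 1)\<^sup>2 + (- f' (\<tau> t) - 1)\<^sup>2"
      by (simp add: power2_eq_square algebra_simps)
  qed auto
  then have "((\<lambda>t. sqrt ((q t - 1)\<^sup>2)) \<longlongrightarrow> sqrt 0) at_top" by (rule tendsto_real_sqrt)
  then have "((\<lambda>t. q t - 1) \<longlongrightarrow> 0) at_top"
    by (simp add: tendsto_rabs_zero_iff)
  from tendsto_add[OF this tendsto_const[of 1]] have "(q \<longlongrightarrow> 1) at_top" by simp
  then have "((\<lambda>t. ln (q t) / \<alpha>) \<longlongrightarrow> ln 1 / \<alpha>) at_top"
    using \<alpha>_pos by (intro tendsto_intros) auto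
  then have "(\<sigma> \<longlongrightarrow> 0) at_top" using \<alpha>_pos by (simp add: q_def)
  then have "((\<lambda>t. p * exp (Complex (\<sigma> t) (\<tau> t))) \<longlongrightarrow> p * exp (Complex 0 0)) at_top"
    by (intro tendsto_intros tendsto_Complex \<tau>_lim)
  then have "((\<lambda>t. p * exp (Complex (\<sigma> t) (\<tau> t))) \<longlongrightarrow> p) at_top"
    by (simp add: zero_complex.code[symmetric])
  moreover have "\<forall>\<^sub>F t in at_top. x t = p * exp (Complex (\<sigma> t) (\<tau> t))"
    using eventually_ge_at_top[of 0] by eventually_elim (rule x_eq)
  ultimately show ?thesis by (simp add: tendsto_cong)
qed

lemma trajectory_exists:
  assumes trap: "trapping \<kappa> \<eta>" and "x0 \<in> box_image \<kappa> \<eta>"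
  shows "\<exists>x. trajectory_on F x {0..} \<and> x 0 = x0"
proof -
  obtain w0 where w0: "x0 = p * exp w0" "\<bar>Im w0\<bar> < \<eta>"
    using assms(2) by (auto simp: box_image_def)
  obtain w where w: "w 0 = w0"
    "\<And>t. 0 \<le> t \<Longrightarrow> (w has_vector_derivative log_field (w t)) (at t)"
    using log_solution_exists[OF trap w0(2)] by metis
  have "((\<lambda>t. p * exp (w t)) has_vector_derivative F (p * exp (w t))) (at t within {0..})"
    if "0 \<le> t" for t
  proof -
    have "((\<lambda>w. p * exp w) has_field_derivative p * exp (w t)) (at (w t) within w ` UNIV)"
      by (auto intro!: derivative_eq_intros)
    from field_vector_diff_chain_within[OF w(2)[OF that] this]
    have "((\<lambda>t. p * exp (w t)) has_vector_derivative F (p * exp (w t))) (at t)"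
      by (simp add: o_def F_exp mult_ac)
    then show ?thesis by (rule has_vector_derivative_at_within)
  qed
  then show ?thesis
    using w(1) w0(1) by (intro exI[of _ "\<lambda>t. p * exp (w t)"]) (auto simp: trajectory_on_def)
qed

lemma asymptotically_stable: "asymptotically_stable F p"
  unfolding asymptotically_stable_def
proof (intro conjI allI impI)
  fix \<epsilon> :: real assume "0 < \<epsilon>"
  then obtain \<kappa> \<eta> where trap: "trapping \<kappa> \<eta>" and sub: "box_image \<kappa> \<eta> \<subseteq> ball p \<epsilon>"
    by (rule small_box_image)
  obtain \<delta> where "0 < \<delta>" "ball p \<delta> \<subseteq> box_image \<kappa> \<eta>"
    by (rule box_image_neighbourhood[OF trap])
  then show "\<exists>\<delta>>0. \<forall>x T. trajectory_on F x {0..<T} \<longrightarrow> x 0 \<in> ball p \<delta> \<longrightarrow>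
      (\<forall>t\<in>{0..<T}. x t \<in> ball p \<epsilon>)"
    using box_image_invariant[OF trap] sub
    by (intro exI[of _ \<delta>]) (meson atLeastLessThan_iff subsetD)
next
  obtain \<kappa> \<eta> where trap: "trapping \<kappa> \<eta>"
    using small_box_image[of 1] by (metis zero_less_one)
  obtain \<delta> where \<delta>: "0 < \<delta>" "ball p \<delta> \<subseteq> box_image \<kappa> \<eta>"
    by (rule box_image_neighbourhood[OF trap])
  have "(x \<longlongrightarrow> p) at_top" if traj: "trajectory_on F x {0..}" and "x 0 \<in> box_image \<kappa> \<eta>" for x
  proof (rule box_image_attracted[OF trap traj])
    fix t :: real assume "0 \<le> t"
    moreover have "trajectory_on F x {0..<t + 1}"
      by (rule trajectory_on_subset[OF traj]) auto
    ultimately show "x t \<in> box_image \<kappa> \<eta>"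
      using box_image_invariant[OF trap, of x "t + 1" t] that(2) by simp
  qed
  then show "\<exists>\<delta>>0. \<forall>x0\<in>ball p \<delta>. (\<exists>x. trajectory_on F x {0..} \<and> x 0 = x0) \<and>
      (\<forall>x. trajectory_on F x {0..} \<longrightarrow> x 0 = x0 \<longrightarrow> (x \<longlongrightarrow> p) at_top)"
    using trajectory_exists[OF trap] \<delta> by (intro exI[of _ \<delta>]) blast
qed

end

section \<open>The pseudo-velocity in polar coordinates\<close>

lemma periodic_int:
  fixes \<psi> :: "real \<Rightarrow> real"
  assumes "\<And>\<theta>. \<psi> (\<theta> + 2 * pi) = \<psi> \<theta>"
  shows "\<psi> (\<theta> + 2 * pi * of_int n) = \<psi> \<theta>"
proof (induction n rule: int_induct[where k = 0])
  case (step1 i)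
  then show ?case using assms[of "\<theta> + 2 * pi * of_int i"] by (simp add: algebra_simps)
next
  case (step2 i)
  then show ?case using assms[of "\<theta> + 2 * pi * of_int (i - 1)"] by (simp add: algebra_simps)
qed simp

lemma periodic_eq_if_cis_eq:
  fixes \<psi> :: "real \<Rightarrow> real"
  assumes "\<And>\<theta>. \<psi> (\<theta> + 2 * pi) = \<psi> \<theta>" and "cis a = cis b"
  shows "\<psi> a = \<psi> b"
proof -
  have "exp (\<i> * of_real a) = exp (\<i> * of_real b)" using assms(2) by (simp add: cis_conv_exp)
  then obtain n :: int where "\<i> * of_real a = \<i> * of_real b + of_int (2 * n) * of_real pi * \<i>"
    by (auto simp: exp_eq)
  then have "a = b + 2 * pi * of_int n" by (simp add: complex_eq_iff)
  then show ?thesis using periodic_int[of \<psi> b n] assms(1) by simp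
qed

lemma homogeneous_stream_rcis:
  assumes "\<And>\<theta>. \<psi> (\<theta> + 2 * pi) = \<psi> \<theta>" and "0 < r"
  shows "homogeneous_stream lam \<psi> (rcis r \<theta>) = r powr lam * \<psi> \<theta>"
proof -
  have "\<psi> (Arg (rcis r \<theta>)) = \<psi> \<theta>"
    by (rule periodic_eq_if_cis_eq, rule assms(1))
      (use assms(2) in \<open>simp add: cis_Arg rcis_def sgn_eq norm_mult\<close>)
  then show ?thesis using assms(2) by (simp add: homogeneous_stream_def)
qed

text \<open>Near \<open>\<xi>\<^sub>0 = rcis r \<theta>\<close> the point \<open>\<xi> = \<xi>\<^sub>0 * exp w\<close> with \<open>w = Ln (\<xi> / \<xi>\<^sub>0)\<close> has modulus
  \<open>r * exp (Re w)\<close> and angle \<open>\<theta> + Im w\<close>. This angle is smooth at \<open>\<xi>\<^sub>0\<close> also on the negative real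
  axis, where \<open>Arg\<close> jumps, and periodicity of \<open>\<psi>\<close> allows its use.\<close>

lemma homogeneous_stream_along_curve:
  fixes c :: "real \<Rightarrow> complex"
  assumes per: "\<And>\<theta>. \<psi> (\<theta> + 2 * pi) = \<psi> \<theta>"
    and \<psi>: "(\<psi> has_real_derivative d) (at \<theta>)"
    and c: "(c has_vector_derivative v) (at s)" "c s = rcis r \<theta>" and "0 < r"
  shows "((\<lambda>s. homogeneous_stream lam \<psi> (c s)) has_real_derivative
      r powr lam * (lam * \<psi> \<theta> * Re (v / rcis r \<theta>) + d * Im (v / rcis r \<theta>))) (at s)"
proof -
  let ?u = "v / rcis r \<theta>"
  have nz: "rcis r \<theta> \<noteq> 0" using \<open>0 < r\<close> by simp
  define w where "w t = Ln (c t / rcis r \<theta>)" for t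
  have one: "c s / rcis r \<theta> = 1" using c(2) nz by simp
  from bounded_linear.has_vector_derivative[OF bounded_linear_divide[of "rcis r \<theta>"] c(1)]
  have quot: "((\<lambda>t. c t / rcis r \<theta>) has_vector_derivative ?u) (at s)" .
  have "(Ln has_field_derivative inverse 1) (at (c s / rcis r \<theta>) within range (\<lambda>t. c t / rcis r \<theta>))"
    unfolding one by (rule has_field_derivative_at_within[OF has_field_derivative_Ln]) auto
  note chain = field_vector_diff_chain_within[OF quot this]
  have w_der: "(w has_vector_derivative ?u) (at s)"
    using chain by (simp add: o_def w_def[abs_def])
  have w_s: "w s = 0" using one by (simp add: w_def)
  have Re_der: "((\<lambda>t. Re (w t)) has_real_derivative Re ?u) (at s)"
    and Im_der: "((\<lambda>t. Im (w t)) has_real_derivative Im ?u) (at s)"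
    using w_der by (auto simp: has_vector_derivative_complex_iff)
  have exp_der: "((\<lambda>t. exp (lam * Re (w t))) has_real_derivative lam * Re ?u) (at s)"
    using DERIV_chain2[OF DERIV_exp DERIV_cmult[OF Re_der, of lam]] by (simp add: w_s)
  have shift: "((\<lambda>t. \<theta> + Im (w t)) has_real_derivative Im ?u) (at s)"
    using DERIV_add[OF DERIV_const Im_der, of \<theta>] by simp
  have "((\<lambda>t. \<psi> (\<theta> + Im (w t))) has_real_derivative d * Im ?u) (at s)"
    by (rule DERIV_chain2[OF _ shift]) (simp add: w_s \<psi>)
  from DERIV_cmult[OF DERIV_mult[OF exp_der this], of "r powr lam"]
  have local: "((\<lambda>t. r powr lam * (exp (lam * Re (w t)) * \<psi> (\<theta> + Im (w t)))) has_real_derivative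
      r powr lam * (lam * \<psi> \<theta> * Re ?u + d * Im ?u)) (at s)"
    by (simp add: w_s mult_ac)
  have "\<forall>\<^sub>F t in nhds s. r powr lam * (exp (lam * Re (w t)) * \<psi> (\<theta> + Im (w t)))
      = homogeneous_stream lam \<psi> (c t)"
  proof -
    have "isCont c s" using c(1) by (rule has_vector_derivative_continuous)
    then have "(c \<longlongrightarrow> c s) (nhds s)" by (simp add: continuous_at tendsto_at_iff_tendsto_nhds)
    moreover have "c s \<noteq> 0" using c(2) nz by simp
    ultimately have "\<forall>\<^sub>F t in nhds s. c t \<noteq> 0" by (rule tendsto_imp_eventually_ne)
    then show ?thesis
    proof eventually_elim
      case (elim t)
      have "rcis (r * exp (Re (w t))) (\<theta> + Im (w t)) = rcis r \<theta> * exp (w t)"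
        by (simp add: rcis_def exp_eq_polar cis_mult[symmetric] mult_ac)
      also have "\<dots> = c t" using elim nz by (simp add: w_def)
      finally have "c t = rcis (r * exp (Re (w t))) (\<theta> + Im (w t))" by simp
      then show ?case
        using homogeneous_stream_rcis[of \<psi> "r * exp (Re (w t))", OF per] \<open>0 < r\<close>
        by (simp add: powr_mult exp_powr_real mult_ac)
    qed
  qed
  from DERIV_cong_ev[OF refl this refl] local show ?thesis by simp
qed

lemma pseudo_velocity_rcis:
  assumes per: "\<And>\<theta>. \<psi> (\<theta> + 2 * pi) = \<psi> \<theta>"
    and \<psi>: "(\<psi> has_real_derivative d) (at \<theta>)" and "0 < r"
  shows "pseudo_velocity \<alpha> (homogeneous_stream lam \<psi>) (rcis r \<theta>) =
    rcis r \<theta> * Complex (- d * r powr (lam - 2) - 1 / \<alpha>) (lam * \<psi> \<theta> * r powr (lam - 2))"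
proof -
  let ?\<xi> = "rcis r \<theta>"
  have x: "((\<lambda>x. Complex x (Im ?\<xi>)) has_vector_derivative 1) (at (Re ?\<xi>))"
    and y: "((\<lambda>y. Complex (Re ?\<xi>) y) has_vector_derivative \<i>) (at (Im ?\<xi>))"
    by (auto simp: has_vector_derivative_complex_iff)
  have e: "r powr lam = r powr (lam - 2) * (r * r)"
    using \<open>0 < r\<close> by (simp add: powr_diff field_simps flip: power2_eq_square)
  have u: "Re (1 / ?\<xi>) = cos \<theta> / r" "Im (1 / ?\<xi>) = - sin \<theta> / r"
    "Re (\<i> / ?\<xi>) = sin \<theta> / r" "Im (\<i> / ?\<xi>) = cos \<theta> / r"
  proof -
    have nz: "?\<xi> \<noteq> 0" using \<open>0 < r\<close> by simp
    have sc: "cos \<theta> * cos \<theta> + sin \<theta> * sin \<theta> = 1"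
      using sin_cos_squared_add[of \<theta>] by (simp add: power2_eq_square)
    have "Complex (cos \<theta> / r) (- sin \<theta> / r) * ?\<xi> = 1"
      "Complex (sin \<theta> / r) (cos \<theta> / r) * ?\<xi> = \<i>"
      using \<open>0 < r\<close> sc by (simp_all add: complex_eq_iff mult_ac)
    then have "1 / ?\<xi> = Complex (cos \<theta> / r) (- sin \<theta> / r)"
      "\<i> / ?\<xi> = Complex (sin \<theta> / r) (cos \<theta> / r)"
      using nz by (metis nonzero_eq_divide_eq)+
    then show "Re (1 / ?\<xi>) = cos \<theta> / r" "Im (1 / ?\<xi>) = - sin \<theta> / r"
      "Re (\<i> / ?\<xi>) = sin \<theta> / r" "Im (\<i> / ?\<xi>) = cos \<theta> / r"
      by (simp_all only: complex.sel)
  qed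
  have dx: "deriv (\<lambda>x. homogeneous_stream lam \<psi> (Complex x (Im ?\<xi>))) (Re ?\<xi>) =
      r powr lam * (lam * \<psi> \<theta> * (cos \<theta> / r) + d * (- sin \<theta> / r))"
    using DERIV_imp_deriv[OF homogeneous_stream_along_curve[OF per \<psi> x _ \<open>0 < r\<close>, where lam = lam]]
    unfolding u by (simp del: Re_rcis Im_rcis)
  have dy: "deriv (\<lambda>y. homogeneous_stream lam \<psi> (Complex (Re ?\<xi>) y)) (Im ?\<xi>) =
      r powr lam * (lam * \<psi> \<theta> * (sin \<theta> / r) + d * (cos \<theta> / r))"
    using DERIV_imp_deriv[OF homogeneous_stream_along_curve[OF per \<psi> y _ \<open>0 < r\<close>, where lam = lam]]
    unfolding u by (simp del: Re_rcis Im_rcis)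
  show ?thesis
    unfolding pseudo_velocity_def perp_grad_def dx dy e
    using \<open>0 < r\<close> by (simp add: complex_eq_iff field_simps)
qed

text \<open>On each line through the origin the angle takes at most three values, so that the stream
  function is \<open>O(\<bar>x\<bar> powr lam)\<close> there, with \<open>lam > 1\<close>.\<close>

lemma pseudo_velocity_origin:
  assumes "1 < lam"
  shows "pseudo_velocity \<alpha> (homogeneous_stream lam \<psi>) 0 = 0"
proof -
  have lim: "(h has_real_derivative 0) (at 0)"
    if h: "\<And>x. \<bar>h x\<bar> \<le> C * \<bar>x\<bar> powr lam" for h :: "real \<Rightarrow> real" and C
  proof -
    have h0: "h 0 = 0" using h[of 0] by simp
    have "((\<lambda>x. C * \<bar>x\<bar> powr (lam - 1)) \<longlongrightarrow> C * 0 powr (lam - 1)) (at 0)"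
      using assms by (intro tendsto_intros tendsto_powr' tendsto_rabs_zero) auto
    then have "((\<lambda>x. C * \<bar>x\<bar> powr (lam - 1)) \<longlongrightarrow> 0) (at 0)" by simp
    moreover have "\<forall>\<^sub>F x in at 0. norm (h x / x) \<le> C * \<bar>x\<bar> powr (lam - 1)"
      using h by (auto simp: eventually_at_filter powr_diff divide_right_mono)
    ultimately have "((\<lambda>x. h x / x) \<longlongrightarrow> 0) (at 0)" by (rule Lim_null_comparison[rotated])
    then show ?thesis by (simp add: has_field_derivative_iff h0)
  qed
  have *: "\<bar>homogeneous_stream lam \<psi> \<xi>\<bar> \<le> C * cmod \<xi> powr lam" if "\<bar>\<psi> (Arg \<xi>)\<bar> \<le> C" for \<xi> C
    using that by (simp add: homogeneous_stream_def abs_mult mult.commute mult_right_mono)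
  have ray: "\<bar>\<psi> (Arg (of_real x * v))\<bar> \<le> max \<bar>\<psi> (Arg v)\<bar> (max \<bar>\<psi> (Arg (- v))\<bar> \<bar>\<psi> 0\<bar>)" for x v
  proof -
    \<comment> \<open>The value \<open>0\<close> is \<open>Arg 0\<close>.\<close>
    have "Arg (of_real x * v) \<in> {Arg v, Arg (- v), 0}"
    proof (cases x "0 :: real" rule: linorder_cases)
      case less
      have "Arg (of_real (- x) * (- v)) = Arg (- v)" by (rule Arg_times_of_real) (use less in simp)
      then show ?thesis by simp
    qed (auto simp: Arg_zero)
    then show ?thesis by auto
  qed
  have "\<bar>homogeneous_stream lam \<psi> (of_real x * v)\<bar> \<le>
      max \<bar>\<psi> (Arg v)\<bar> (max \<bar>\<psi> (Arg (- v))\<bar> \<bar>\<psi> 0\<bar>) * \<bar>x\<bar> powr lam" if "cmod v = 1" for x v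
    using *[OF ray[of x v]] that by (simp add: norm_mult)
  from lim[OF this] have d: "deriv (\<lambda>x. homogeneous_stream lam \<psi> (of_real x * v)) 0 = 0" if "cmod v = 1" for v
    using that by (intro DERIV_imp_deriv) blast
  have "Complex x 0 = of_real x * 1" "Complex 0 x = of_real x * \<i>" for x
    by (simp_all add: complex_eq_iff)
  then show ?thesis
    using d[of 1] d[of \<i>] by (simp add: pseudo_velocity_def perp_grad_def zero_complex.code[symmetric])
qed

section \<open>The glued profile at its nodes\<close>

text \<open>Near \<open>a\<close> the derivative does not vanish, so by continuity its sign is constant there. It must be
  positive, as \<open>\<phi>\<close> grows from \<open>0\<close>.\<close>

lemma slope_limit_at_right_zero:
  fixes \<phi> d :: "real \<Rightarrow> real"
  assumes "a < b" and lim: "(\<phi> \<longlongrightarrow> 0) (at_right a)"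
    and pos: "\<And>\<theta>. a < \<theta> \<Longrightarrow> \<theta> < b \<Longrightarrow> 0 < \<phi> \<theta>"
    and der: "\<And>\<theta>. a < \<theta> \<Longrightarrow> \<theta> < b \<Longrightarrow> (\<phi> has_real_derivative d \<theta>) (at \<theta>)"
    and cont: "\<And>\<theta>. a < \<theta> \<Longrightarrow> \<theta> < b \<Longrightarrow> isCont d \<theta>"
    and sq: "((\<lambda>\<theta>. (d \<theta>)\<^sup>2) \<longlongrightarrow> m\<^sup>2) (at_right a)" and "0 < m"
  shows "(d \<longlongrightarrow> m) (at_right a)"
proof -
  have abs_lim: "((\<lambda>\<theta>. \<bar>d \<theta>\<bar>) \<longlongrightarrow> m) (at_right a)"
    using tendsto_real_sqrt[OF sq] \<open>0 < m\<close> by simp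
  have "\<forall>\<^sub>F \<theta> in at_right a. 0 < \<bar>d \<theta>\<bar>" using order_tendstoD(1)[OF abs_lim \<open>0 < m\<close>] .
  then obtain c0 where c0: "a < c0" "\<And>\<theta>. a < \<theta> \<Longrightarrow> \<theta> < c0 \<Longrightarrow> d \<theta> \<noteq> 0"
    unfolding eventually_at_right_field by auto
  define c where "c = min b c0"
  have c: "a < c" "c \<le> b" "\<And>\<theta>. a < \<theta> \<Longrightarrow> \<theta> < c \<Longrightarrow> d \<theta> \<noteq> 0"
    using c0 \<open>a < b\<close> by (auto simp: c_def)
  have d_pos: "0 < d \<theta>" if \<theta>: "a < \<theta>" "\<theta> < c" for \<theta>
  proof (rule ccontr)
    assume "\<not> 0 < d \<theta>"
    then have neg: "d \<theta> < 0" using c(3)[OF \<theta>] by simp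
    have d_neg: "d s < 0" if s: "a < s" "s \<le> \<theta>" for s
    proof (rule ccontr)
      assume "\<not> d s < 0"
      moreover have "continuous_on {s..\<theta>} d"
        using cont s \<theta> c(2) by (intro continuous_at_imp_continuous_on) auto
      ultimately obtain z where "s \<le> z" "z \<le> \<theta>" "d z = 0"
        using IVT2'[of d \<theta> 0 s] neg s by auto
      then show False using c(3)[of z] s \<theta> by auto
    qed
    have "\<phi> \<theta> \<le> \<phi> s" if s: "a < s" "s < \<theta>" for s
    proof (rule DERIV_nonpos_imp_nonincreasing[where f = \<phi>])
      show "\<exists>y. (\<phi> has_real_derivative y) (at z) \<and> y \<le> 0" if "s \<le> z" "z \<le> \<theta>" for z
        using der[of z] d_neg[of z] s \<theta> c(2) that by (intro exI[of _ "d z"]) auto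
    qed (use s in simp)
    then have "\<forall>\<^sub>F s in at_right a. \<phi> \<theta> \<le> \<phi> s"
      unfolding eventually_at_right_field using \<theta>(1) by blast
    then have "\<phi> \<theta> \<le> 0" by (rule tendsto_lowerbound[OF lim]) simp
    then show False using pos[of \<theta>] \<theta> c(2) by simp
  qed
  have "\<forall>\<^sub>F \<theta> in at_right a. \<bar>d \<theta>\<bar> = d \<theta>"
    unfolding eventually_at_right_field using c(1) d_pos by (intro exI[of _ c]) (auto simp: abs_of_pos)
  then show ?thesis using abs_lim by (rule Lim_transform_eventually[rotated])
qed

text \<open>The reflection \<open>\<theta> \<mapsto> - \<theta>\<close> exchanges the two end points and the sign of the slope.\<close>

lemma slope_limit_at_left_zero:
  fixes \<phi> d :: "real \<Rightarrow> real"
  assumes "a < b" and lim: "(\<phi> \<longlongrightarrow> 0) (at_left b)"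
    and pos: "\<And>\<theta>. a < \<theta> \<Longrightarrow> \<theta> < b \<Longrightarrow> 0 < \<phi> \<theta>"
    and der: "\<And>\<theta>. a < \<theta> \<Longrightarrow> \<theta> < b \<Longrightarrow> (\<phi> has_real_derivative d \<theta>) (at \<theta>)"
    and cont: "\<And>\<theta>. a < \<theta> \<Longrightarrow> \<theta> < b \<Longrightarrow> isCont d \<theta>"
    and sq: "((\<lambda>\<theta>. (d \<theta>)\<^sup>2) \<longlongrightarrow> m\<^sup>2) (at_left b)" and "0 < m"
  shows "(d \<longlongrightarrow> - m) (at_left b)"
proof -
  have "((\<lambda>\<theta>. - d (- \<theta>)) \<longlongrightarrow> m) (at_right (- b))"
  proof (rule slope_limit_at_right_zero[where \<phi> = "\<lambda>\<theta>. \<phi> (- \<theta>)" and b = "- a"])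
    show "((\<lambda>\<theta>. \<phi> (- \<theta>)) \<longlongrightarrow> 0) (at_right (- b))"
      using lim by (simp add: filterlim_at_left_to_right)
    show "((\<lambda>\<theta>. (- d (- \<theta>))\<^sup>2) \<longlongrightarrow> m\<^sup>2) (at_right (- b))"
      using sq by (simp add: filterlim_at_left_to_right)
    fix \<theta> assume \<theta>: "- b < \<theta>" "\<theta> < - a"
    show "((\<lambda>\<theta>. \<phi> (- \<theta>)) has_real_derivative - d (- \<theta>)) (at \<theta>)"
      using DERIV_chain2[OF der[of "- \<theta>"] DERIV_minus[OF DERIV_ident]] \<theta> by simp
    have "isCont (\<lambda>\<theta>. d (- \<theta>)) \<theta>"
      using cont[of "- \<theta>"] \<theta> by (intro isCont_o2[of _ uminus d] continuous_intros) auto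
    then show "isCont (\<lambda>\<theta>. - d (- \<theta>)) \<theta>" by (rule continuous_minus)
  qed (use assms in auto)
  from tendsto_minus[OF this] show ?thesis by (simp add: filterlim_at_left_to_right)
qed

text \<open>L'Hospital's rule for the difference quotient of \<open>\<psi>\<close> at \<open>c\<close>.\<close>

lemma DERIV_at_removable_point:
  fixes \<psi> d :: "real \<Rightarrow> real"
  assumes "isCont \<psi> c" "\<forall>\<^sub>F \<theta> in at c. (\<psi> has_real_derivative d \<theta>) (at \<theta>)"
    and "(d \<longlongrightarrow> l) (at c)"
  shows "(\<psi> has_real_derivative l) (at c)"
proof -
  have "((\<lambda>\<theta>. (\<psi> \<theta> - \<psi> c) / (\<theta> - c)) \<longlongrightarrow> l) (at c)"
  proof (rule lhopital[where f' = d and g' = "\<lambda>_. 1"])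
    show "((\<lambda>\<theta>. \<psi> \<theta> - \<psi> c) \<longlongrightarrow> 0) (at c)"
      using assms(1) by (simp add: continuous_at LIM_zero_iff)
    show "((\<lambda>\<theta>. \<theta> - c) \<longlongrightarrow> 0) (at c)" by (simp add: LIM_zero_iff)
    show "\<forall>\<^sub>F \<theta> in at c. \<theta> - c \<noteq> 0" by (simp add: eventually_at_filter)
    show "\<forall>\<^sub>F \<theta> in at c. ((\<lambda>\<theta>. \<psi> \<theta> - \<psi> c) has_real_derivative d \<theta>) (at \<theta>)"
      using assms(2) by eventually_elim (auto intro!: derivative_eq_intros)
    show "\<forall>\<^sub>F \<theta> in at c. ((\<lambda>\<theta>. \<theta> - c) has_real_derivative 1) (at \<theta>)"
      by (auto intro!: always_eventually derivative_eq_intros)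
  qed (use assms(3) in auto)
  then show ?thesis by (simp add: has_field_derivative_iff)
qed

text \<open>Solving \<open>bernoulli lam P \<phi> \<theta> = B\<close> for \<open>(\<phi>')\<^sup>2\<close> gives
  \<open>B * \<phi> powr (2 - 2 / lam) - lam\<^sup>2 * \<phi>\<^sup>2 - 2 * P\<close>, and the exponent \<open>2 - 2 / lam\<close> is positive.\<close>

lemma positive_local_solution_slope_limit:
  assumes sol: "positive_local_solution lam P B \<phi> a b" and "1 < lam"
    and inside: "\<forall>\<^sub>F \<theta> in G. a < \<theta> \<and> \<theta> < b" and lim: "(\<phi> \<longlongrightarrow> 0) G"
  shows "((\<lambda>\<theta>. (deriv \<phi> \<theta>)\<^sup>2) \<longlongrightarrow> - 2 * P) G"
proof -
  have pos: "0 < \<phi> \<theta>" if "a < \<theta>" "\<theta> < b" for \<theta>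
    using sol that by (auto simp: positive_local_solution_def)
  have eq: "B * \<phi> \<theta> powr (2 - 2 / lam) - lam\<^sup>2 * (\<phi> \<theta>)\<^sup>2 - 2 * P = (deriv \<phi> \<theta>)\<^sup>2"
    if \<theta>: "a < \<theta>" "\<theta> < b" for \<theta>
  proof -
    have "B * \<phi> \<theta> powr (2 - 2 / lam) = (2 * P + (deriv \<phi> \<theta>)\<^sup>2 + lam\<^sup>2 * (\<phi> \<theta>)\<^sup>2)
        * (\<phi> \<theta> powr (2 / lam - 2) * \<phi> \<theta> powr (2 - 2 / lam))"
      using sol \<theta> by (auto simp: positive_local_solution_def bernoulli_def)
    also have "\<phi> \<theta> powr (2 / lam - 2) * \<phi> \<theta> powr (2 - 2 / lam) = 1"
      using pos[OF \<theta>] by (simp add: powr_add[symmetric])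
    finally show ?thesis by simp
  qed
  have "0 < 2 - 2 / lam" using \<open>1 < lam\<close> by (simp add: field_simps)
  moreover have "\<forall>\<^sub>F \<theta> in G. 0 \<le> \<phi> \<theta>"
    using inside by eventually_elim (use pos in \<open>auto intro: less_imp_le\<close>)
  ultimately have "((\<lambda>\<theta>. \<phi> \<theta> powr (2 - 2 / lam)) \<longlongrightarrow> 0 powr (2 - 2 / lam)) G"
    by (intro tendsto_powr' lim tendsto_const) auto
  then have "((\<lambda>\<theta>. B * \<phi> \<theta> powr (2 - 2 / lam) - lam\<^sup>2 * (\<phi> \<theta>)\<^sup>2 - 2 * P)
      \<longlongrightarrow> B * 0 - lam\<^sup>2 * 0\<^sup>2 - 2 * P) G"
    by (intro tendsto_intros lim) simp
  moreover have "\<forall>\<^sub>F \<theta> in G. B * \<phi> \<theta> powr (2 - 2 / lam) - lam\<^sup>2 * (\<phi> \<theta>)\<^sup>2 - 2 * P = (deriv \<phi> \<theta>)\<^sup>2"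
    using inside by eventually_elim (use eq in auto)
  ultimately show ?thesis by (simp add: tendsto_cong)
qed

text \<open>The properties of a glued solution that determine the dynamics: \<open>\<psi>\<close> crosses zero upwards at the
  even nodes and downwards at the odd ones, always with a slope of modulus \<open>m\<close>.\<close>

definition nodal_profile :: "real \<Rightarrow> nat \<Rightarrow> (real \<Rightarrow> real) \<Rightarrow> (nat \<Rightarrow> real) \<Rightarrow> bool" where
  "nodal_profile m k \<psi> t \<longleftrightarrow> (\<forall>\<theta>. \<psi> (\<theta> + 2 * pi) = \<psi> \<theta>) \<and> t (2 * k) = t 0 + 2 * pi \<and>
     (\<forall>i<2 * k. t i < t (Suc i) \<and>
        (\<forall>\<theta>\<in>{t i<..<t (Suc i)}. 0 < (-1) ^ i * \<psi> \<theta> \<and> \<psi> differentiable (at \<theta>)) \<and>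
        \<psi> (t i) = 0 \<and> (\<psi> has_real_derivative (-1) ^ i * m) (at (t i)) \<and> isCont (deriv \<psi>) (t i))"

lemma deriv_periodic:
  fixes \<psi> :: "real \<Rightarrow> real"
  assumes "\<And>\<theta>. \<psi> (\<theta> + 2 * pi) = \<psi> \<theta>"
  shows "deriv \<psi> (\<theta> + 2 * pi) = deriv \<psi> \<theta>"
  using assms by (simp add: deriv_def DERIV_shift)

lemma filterlim_shift_at_left:
  "filterlim (\<lambda>x. x + c) (at_left (a + c)) (at_left (a :: real))"
  by (auto simp: filterlim_at eventually_at_filter intro!: tendsto_eq_intros)

text \<open>At a node the derivatives of the two adjacent pieces have the same limit, since the slopes
  \<open>m\<close> at the left and \<open>- m\<close> at the right end of a positive piece are multiplied by alternating
  signs. For the node \<open>t 0\<close> the piece on the left is the last one, shifted by a period.\<close>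

lemma glued_solution_nodal_profile:
  assumes "1 < lam" "P < 0" and glued: "glued_solution lam P k \<psi>"
  obtains t where "nodal_profile (sqrt (- 2 * P)) k \<psi> t"
proof -
  define m where "m = sqrt (- 2 * P)"
  have m: "0 < m" "m\<^sup>2 = - 2 * P" using \<open>P < 0\<close> by (simp_all add: m_def)
  have cont: "continuous_on UNIV \<psi>" and per: "\<And>\<theta>. \<psi> (\<theta> + 2 * pi) = \<psi> \<theta>"
    using glued by (simp_all add: glued_solution_def)
  obtain t where t: "t (2 * k) = t 0 + 2 * pi" "\<And>i. i \<le> 2 * k \<Longrightarrow> \<psi> (t i) = 0"
    and max: "\<And>i. i < 2 * k \<Longrightarrow>
      \<exists>B\<in>{1, -1}. maximal_local_solution lam P B (\<lambda>\<theta>. (-1) ^ i * \<psi> \<theta>) (t i) (t (Suc i))"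
    using glued unfolding glued_solution_def by blast
  have sol: "\<exists>B. positive_local_solution lam P B (\<lambda>\<theta>. (-1) ^ i * \<psi> \<theta>) (t i) (t (Suc i))"
    if i: "i < 2 * k" for i
  proof -
    obtain B where "maximal_local_solution lam P B (\<lambda>\<theta>. (-1) ^ i * \<psi> \<theta>) (t i) (t (Suc i))"
      using max[OF i] by blast
    then show ?thesis unfolding maximal_local_solution_def by (intro exI) (rule conjunct1)
  qed
  have isCont: "isCont \<psi> \<theta>" for \<theta>
    using cont by (simp add: continuous_on_eq_continuous_at)
  have lt: "t i < t (Suc i)" if "i < 2 * k" for i
    using sol[OF that] by (auto simp: positive_local_solution_def)
  have pos: "0 < (-1) ^ i * \<psi> \<theta>" if "i < 2 * k" "t i < \<theta>" "\<theta> < t (Suc i)" for i \<theta>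
    using sol[OF that(1)] that(2,3) by (auto simp: positive_local_solution_def)
  have sgn2: "(-1) ^ i * ((-1) ^ i * x) = x" for i and x :: real
    by (simp flip: mult.assoc power_mult_distrib)
  have diff: "((\<lambda>\<theta>. (-1) ^ i * \<psi> \<theta>) has_real_derivative (-1) ^ i * deriv \<psi> \<theta>) (at \<theta>)"
    "(\<psi> has_real_derivative deriv \<psi> \<theta>) (at \<theta>)"
    "isCont (deriv (\<lambda>\<theta>. (-1) ^ i * \<psi> \<theta>)) \<theta>"
    if "i < 2 * k" "t i < \<theta>" "\<theta> < t (Suc i)" for i \<theta>
  proof -
    have ode: "angular_ode_at lam P (\<lambda>\<theta>. (-1) ^ i * \<psi> \<theta>) \<theta>"
      using sol[OF that(1)] that(2,3) by (auto simp: positive_local_solution_def)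
    then obtain D where "((\<lambda>\<theta>. (-1) ^ i * \<psi> \<theta>) has_real_derivative D) (at \<theta>)"
      by (auto simp: angular_ode_at_def real_differentiable_def)
    from DERIV_cmult[OF this, of "(-1) ^ i"] show \<psi>: "(\<psi> has_real_derivative deriv \<psi> \<theta>) (at \<theta>)"
      unfolding sgn2 by (metis DERIV_imp_deriv)
    then show "((\<lambda>\<theta>. (-1) ^ i * \<psi> \<theta>) has_real_derivative (-1) ^ i * deriv \<psi> \<theta>) (at \<theta>)"
      by (rule DERIV_cmult)
    show "isCont (deriv (\<lambda>\<theta>. (-1) ^ i * \<psi> \<theta>)) \<theta>"
      using ode unfolding angular_ode_at_def by (blast intro: differentiable_imp_continuous_within)
  qed
  have d_eq: "deriv (\<lambda>\<theta>. (-1) ^ i * \<psi> \<theta>) \<theta> = (-1) ^ i * deriv \<psi> \<theta>"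
    if "i < 2 * k" "t i < \<theta>" "\<theta> < t (Suc i)" for i \<theta>
    using diff(1)[OF that] by (rule DERIV_imp_deriv)
  have lim0: "((\<lambda>\<theta>. (-1) ^ i * \<psi> \<theta>) \<longlongrightarrow> 0) (at (t j) within S)" if "j \<le> 2 * k" for i j S
  proof -
    have "(\<psi> \<longlongrightarrow> \<psi> (t j)) (at (t j) within S)"
      using isCont[of "t j"] by (auto simp: continuous_at intro: tendsto_within_subset)
    from tendsto_mult_left[OF this] show ?thesis using t(2)[OF that] by simp
  qed
  have in_right: "\<forall>\<^sub>F \<theta> in at_right (t i). t i < \<theta> \<and> \<theta> < t (Suc i)"
    and in_left: "\<forall>\<^sub>F \<theta> in at_left (t (Suc i)). t i < \<theta> \<and> \<theta> < t (Suc i)" if "i < 2 * k" for i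
    using lt[OF that] eventually_at_right_real eventually_at_left_real by fastforce+
  have right: "(deriv \<psi> \<longlongrightarrow> (-1) ^ i * m) (at_right (t i))" if i: "i < 2 * k" for i
  proof -
    obtain B where B: "positive_local_solution lam P B (\<lambda>\<theta>. (-1) ^ i * \<psi> \<theta>) (t i) (t (Suc i))"
      using sol[OF i] by blast
    have "(deriv (\<lambda>\<theta>. (-1) ^ i * \<psi> \<theta>) \<longlongrightarrow> m) (at_right (t i))"
      by (rule slope_limit_at_right_zero[where \<phi> = "\<lambda>\<theta>. (-1) ^ i * \<psi> \<theta>" and b = "t (Suc i)"])
        (use i lt pos diff d_eq lim0[of i] m positive_local_solution_slope_limit[OF B \<open>1 < lam\<close> in_right[OF i]]
          in auto)
    from tendsto_mult_left[OF this, of "(-1) ^ i"]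
    have lim: "((\<lambda>\<theta>. (-1) ^ i * deriv (\<lambda>\<theta>. (-1) ^ i * \<psi> \<theta>) \<theta>) \<longlongrightarrow> (-1) ^ i * m) (at_right (t i))" .
    show ?thesis
      by (rule Lim_transform_eventually[OF lim], rule eventually_mono[OF in_right[OF i]])
        (simp add: d_eq[OF i] sgn2)
  qed
  have left: "(deriv \<psi> \<longlongrightarrow> (-1) ^ Suc i * m) (at_left (t (Suc i)))" if i: "i < 2 * k" for i
  proof -
    obtain B where B: "positive_local_solution lam P B (\<lambda>\<theta>. (-1) ^ i * \<psi> \<theta>) (t i) (t (Suc i))"
      using sol[OF i] by blast
    have "(deriv (\<lambda>\<theta>. (-1) ^ i * \<psi> \<theta>) \<longlongrightarrow> - m) (at_left (t (Suc i)))"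
      by (rule slope_limit_at_left_zero[where \<phi> = "\<lambda>\<theta>. (-1) ^ i * \<psi> \<theta>" and a = "t i"])
        (use i lt pos diff d_eq lim0[of "Suc i"] m
          positive_local_solution_slope_limit[OF B \<open>1 < lam\<close> in_left[OF i]] in auto)
    from tendsto_mult_left[OF this, of "(-1) ^ i"]
    have lim: "((\<lambda>\<theta>. (-1) ^ i * deriv (\<lambda>\<theta>. (-1) ^ i * \<psi> \<theta>) \<theta>) \<longlongrightarrow> (-1) ^ Suc i * m) (at_left (t (Suc i)))"
      by simp
    show ?thesis
      by (rule Lim_transform_eventually[OF lim], rule eventually_mono[OF in_left[OF i]])
        (simp add: d_eq[OF i] sgn2)
  qed
  have right_der: "\<forall>\<^sub>F \<theta> in at_right (t i). (\<psi> has_real_derivative deriv \<psi> \<theta>) (at \<theta>)" if i: "i < 2 * k" for i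
    using in_right[OF i] by eventually_elim (use diff(2)[OF i] in blast)
  have left_der: "\<forall>\<^sub>F \<theta> in at_left (t (Suc i)). (\<psi> has_real_derivative deriv \<psi> \<theta>) (at \<theta>)" if i: "i < 2 * k" for i
    using in_left[OF i] by eventually_elim (use diff(2)[OF i] in blast)
  have node_left: "(deriv \<psi> \<longlongrightarrow> (-1) ^ i * m) (at_left (t i)) \<and>
      (\<forall>\<^sub>F \<theta> in at_left (t i). (\<psi> has_real_derivative deriv \<psi> \<theta>) (at \<theta>))" if i: "i < 2 * k" for i
  proof (cases i)
    case (Suc j)
    then show ?thesis using left[of j] left_der[of j] i by simp
  next
    case 0
    obtain j where j: "2 * k = Suc j" using i by (cases "2 * k") auto
    \<comment> \<open>The number of pieces is even, so the slopes also match across the period.\<close>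
    have odd: "(-1 :: real) ^ Suc j = 1" unfolding j[symmetric] by simp
    have "(deriv \<psi> \<longlongrightarrow> m) (at_left (t 0 + 2 * pi))"
      using left[of j] j t(1) odd by simp
    from filterlim_compose[OF this filterlim_shift_at_left] have "(deriv \<psi> \<longlongrightarrow> m) (at_left (t 0))"
      by (simp add: deriv_periodic[of \<psi>, OF per])
    moreover have "\<forall>\<^sub>F \<theta> in at_left (t 0). (\<psi> has_real_derivative deriv \<psi> \<theta>) (at \<theta>)"
    proof -
      have "\<forall>\<^sub>F \<theta> in at_left (t 0 + 2 * pi). (\<psi> has_real_derivative deriv \<psi> \<theta>) (at \<theta>)"
        using left_der[of j] j t(1) by simp
      then have "\<forall>\<^sub>F \<theta> in at_left (t 0).
          (\<psi> has_real_derivative deriv \<psi> (\<theta> + 2 * pi)) (at (\<theta> + 2 * pi))"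
        by (rule eventually_compose_filterlim[OF _ filterlim_shift_at_left])
      then show ?thesis by eventually_elim (simp add: deriv_periodic[of \<psi>, OF per] DERIV_shift per)
    qed
    ultimately show ?thesis using 0 by simp
  qed
  have node: "(\<psi> has_real_derivative (-1) ^ i * m) (at (t i)) \<and> isCont (deriv \<psi>) (t i)"
    if i: "i < 2 * k" for i
  proof -
    have lim: "(deriv \<psi> \<longlongrightarrow> (-1) ^ i * m) (at (t i))"
      using right[OF i] node_left[OF i] by (simp add: filterlim_at_split)
    have "\<forall>\<^sub>F \<theta> in at (t i). (\<psi> has_real_derivative deriv \<psi> \<theta>) (at \<theta>)"
      using right_der[OF i] node_left[OF i] by (simp add: eventually_at_split)
    then have "(\<psi> has_real_derivative (-1) ^ i * m) (at (t i))"
      by (rule DERIV_at_removable_point[OF isCont _ lim])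
    moreover from this have "deriv \<psi> (t i) = (-1) ^ i * m" by (rule DERIV_imp_deriv)
    ultimately show ?thesis using lim by (simp add: continuous_at)
  qed
  have "\<psi> differentiable (at \<theta>)" if "i < 2 * k" "t i < \<theta>" "\<theta> < t (Suc i)" for i \<theta>
    using diff(2)[OF that] unfolding real_differentiable_def by blast
  then have "nodal_profile m k \<psi> t"
    unfolding nodal_profile_def using per t lt pos node by auto
  then show thesis using that by (simp add: m_def)
qed

locale nodal_angular_profile =
  fixes m :: real and k :: nat and \<psi> :: "real \<Rightarrow> real" and t :: "nat \<Rightarrow> real"
  assumes m_pos: "0 < m" and profile: "nodal_profile m k \<psi> t"
begin

lemma periodic: "\<psi> (\<theta> + 2 * pi) = \<psi> \<theta>"
  using profile by (simp add: nodal_profile_def)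

lemma shift_int: "\<psi> (\<theta> + 2 * pi * of_int n) = \<psi> \<theta>" "deriv \<psi> (\<theta> + 2 * pi * of_int n) = deriv \<psi> \<theta>"
  by (rule periodic_int, simp add: periodic deriv_periodic)+

lemma last_node: "t (2 * k) = t 0 + 2 * pi"
  using profile by (simp add: nodal_profile_def)

lemma k_pos: "0 < k"
  using last_node pi_gt_zero by (cases k) auto

lemma node:
  assumes "i < 2 * k"
  shows "t i < t (Suc i)" "\<psi> (t i) = 0" "(\<psi> has_real_derivative (-1) ^ i * m) (at (t i))"
    "deriv \<psi> (t i) = (-1) ^ i * m" "isCont (deriv \<psi>) (t i)"
  using profile assms DERIV_imp_deriv unfolding nodal_profile_def by blast+

lemma between_nodes:
  assumes "i < 2 * k" "t i < \<theta>" "\<theta> < t (Suc i)"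
  shows "\<psi> \<theta> \<noteq> 0" "\<psi> differentiable (at \<theta>)"
proof -
  have "0 < (-1) ^ i * \<psi> \<theta> \<and> \<psi> differentiable (at \<theta>)"
    using profile assms unfolding nodal_profile_def by simp
  then show "\<psi> \<theta> \<noteq> 0" "\<psi> differentiable (at \<theta>)" by auto
qed

lemma node_less:
  assumes "i < j" "j \<le> 2 * k"
  shows "t i < t j"
  using assms
proof (induction j)
  case (Suc j)
  then show ?case using node(1)[of j] by (cases "i = j") force+
qed simp

text \<open>The cells between consecutive nodes tile one period.\<close>

lemma cell:
  obtains i n where "i < 2 * k" "t i \<le> \<theta> + 2 * pi * of_int n" "\<theta> + 2 * pi * of_int n < t (Suc i)"
proof -
  have cover: "t 0 \<le> x \<Longrightarrow> x < t N \<Longrightarrow> \<exists>i<N. t i \<le> x \<and> x < t (Suc i)" for x N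
  proof (induction N)
    case (Suc N)
    then show ?case by (cases "x < t N") (auto simp: less_Suc_eq)
  qed simp
  define n :: int where "n = - \<lfloor>(\<theta> - t 0) / (2 * pi)\<rfloor>"
  have "of_int (- n) \<le> (\<theta> - t 0) / (2 * pi)" "(\<theta> - t 0) / (2 * pi) < of_int (- n) + 1"
    unfolding n_def by linarith+
  then have "t 0 \<le> \<theta> + 2 * pi * of_int n" "\<theta> + 2 * pi * of_int n < t (2 * k)"
    unfolding last_node by (simp_all add: field_simps)
  from cover[OF this] show thesis using that by blast
qed

lemma zero_is_node:
  assumes "\<psi> \<theta> = 0"
  obtains i n where "i < 2 * k" "\<theta> + 2 * pi * of_int n = t i"
proof -
  obtain i n where i: "i < 2 * k" "t i \<le> \<theta> + 2 * pi * of_int n" "\<theta> + 2 * pi * of_int n < t (Suc i)"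
    by (rule cell)
  have "\<psi> (\<theta> + 2 * pi * of_int n) = 0" using assms shift_int by simp
  then have "\<theta> + 2 * pi * of_int n = t i"
    using between_nodes(1)[OF i(1) _ i(3)] i(2) by fastforce
  with i(1) show thesis using that by blast
qed

lemma has_deriv: "(\<psi> has_real_derivative deriv \<psi> \<theta>) (at \<theta>)"
proof -
  obtain i n where i: "i < 2 * k" "t i \<le> \<theta> + 2 * pi * of_int n" "\<theta> + 2 * pi * of_int n < t (Suc i)"
    by (rule cell)
  have "\<exists>D. (\<psi> has_real_derivative D) (at (\<theta> + 2 * pi * of_int n))"
    using node(3)[OF i(1)] between_nodes(2)[OF i(1) _ i(3)] i(2)
    unfolding real_differentiable_def by (metis order_le_less)
  then show ?thesis by (auto simp: DERIV_shift shift_int dest: DERIV_imp_deriv)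
qed

text \<open>Two distinct nodes among \<open>t 0, \<dots>, t (2 * k - 1)\<close> differ by less than a period.\<close>

lemma node_cis_inj:
  assumes "i < 2 * k" "j < 2 * k" "cis (t i) = cis (t j)"
  shows "i = j"
proof -
  have *: "i = j" if ij: "i \<le> j" "j < 2 * k" "cis (t i) = cis (t j)" for i j
  proof (rule ccontr)
    assume "i \<noteq> j"
    with ij have "i < j" by simp
    have "0 < t j - t i" using node_less[OF \<open>i < j\<close>] ij by simp
    moreover have "t j < t (2 * k)" "t 0 \<le> t i"
      using node_less[of j "2 * k"] node_less[of 0 i] ij by (cases "i = 0"; simp)+
    then have "t j - t i < 2 * pi" using last_node by simp
    moreover have "cis (t j - t i) = 1" using ij(3) by (simp add: cis_divide[symmetric])
    then have "cos (t j - t i) = 1" by (simp add: complex_eq_iff)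
    then obtain n :: int where "t j - t i = of_int n * (2 * pi)" by (auto simp: cos_one_2pi_int)
    ultimately have "0 < n" "n < 1" by (auto simp: zero_less_mult_iff)
    then show False by simp
  qed
  show ?thesis using *[of i j] *[of j i] assms by (cases "i \<le> j") auto
qed

text \<open>A sign change forces a zero; at the even nodes \<open>\<psi>\<close> has positive slope and so changes sign from
  negative to positive.\<close>

lemma changes_sign_at_odd_node:
  assumes "changes_pos_to_neg_at \<psi> \<theta>"
  obtains i n where "i < 2 * k" "odd i" "\<theta> + 2 * pi * of_int n = t i"
proof -
  have left: "\<forall>\<^sub>F s in at_left \<theta>. 0 < \<psi> s" and right: "\<forall>\<^sub>F s in at_right \<theta>. \<psi> s < 0"
    using assms by (auto simp: changes_pos_to_neg_at_def)
  have lim: "(\<psi> \<longlongrightarrow> \<psi> \<theta>) (at \<theta> within S)" for S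
    using DERIV_isCont[OF has_deriv[of \<theta>]] by (auto simp: continuous_at intro: tendsto_within_subset)
  have "0 \<le> \<psi> \<theta>"
    by (rule tendsto_lowerbound[OF lim eventually_mono[OF left]]) auto
  moreover have "\<psi> \<theta> \<le> 0"
    by (rule tendsto_upperbound[OF lim eventually_mono[OF right]]) auto
  ultimately have zero: "\<psi> \<theta> = 0" by simp
  then obtain i n where i: "i < 2 * k" "\<theta> + 2 * pi * of_int n = t i" by (rule zero_is_node)
  have "odd i"
  proof
    assume "even i"
    then have "(\<psi> has_real_derivative m) (at \<theta>)"
      using has_deriv[of \<theta>] node(4)[OF i(1)] shift_int(2)[of \<theta> n] i(2) by simp
    then obtain d where d: "0 < d" "\<And>h. 0 < h \<Longrightarrow> h < d \<Longrightarrow> \<psi> \<theta> < \<psi> (\<theta> + h)"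
      using DERIV_pos_inc_right m_pos by blast
    obtain b where b: "\<theta> < b" "\<And>s. \<theta> < s \<Longrightarrow> s < b \<Longrightarrow> \<psi> s < 0"
      using right unfolding eventually_at_right_field by auto
    define e where "e = min d (b - \<theta>)"
    have "0 < e" "e \<le> d" "e \<le> b - \<theta>" using d(1) b(1) by (auto simp: e_def)
    then have "0 < e / 2" "e / 2 < d" "\<theta> + e / 2 < b" by simp_all
    then show False using d(2)[of "e / 2"] b(2)[of "\<theta> + e / 2"] zero by simp
  qed
  with i show thesis using that by blast
qed

end

section \<open>Stagnation points, sinks and the saddle at the origin\<close>

lemma card_odd_below: "card {i. i < 2 * k \<and> odd i} = k" "finite {i. i < 2 * k \<and> odd (i :: nat)}"
proof -
  have "{i. i < 2 * k \<and> odd i} = (\<lambda>j. 2 * j + 1) ` {..<k}"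
    by (auto elim!: oddE)
  then show "card {i. i < 2 * k \<and> odd i} = k"
    by (simp add: card_image inj_on_def)
  show "finite {i. i < 2 * k \<and> odd (i :: nat)}" by simp
qed

locale self_similar_flow = nodal_angular_profile +
  fixes lam \<alpha> :: real and F :: "complex \<Rightarrow> complex"
  assumes lam: "1 < lam" "lam < 2" and \<alpha>: "\<alpha> = 2 - lam"
    and F: "F = pseudo_velocity \<alpha> (homogeneous_stream lam \<psi>)"
begin

lemma \<alpha>_pos: "0 < \<alpha>"
  using lam \<alpha> by simp

lemma F_rcis:
  assumes "0 < r"
  shows "F (rcis r \<theta>) =
    rcis r \<theta> * Complex (- deriv \<psi> \<theta> * r powr - \<alpha> - 1 / \<alpha>) (lam * \<psi> \<theta> * r powr - \<alpha>)"
  unfolding F using pseudo_velocity_rcis[of \<psi>, OF periodic has_deriv assms] \<alpha> by simp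

lemma F_origin: "F 0 = 0"
  unfolding F by (rule pseudo_velocity_origin[OF lam(1)])

definition sink_radius :: real where
  "sink_radius = (\<alpha> * m) powr (1 / \<alpha>)"

lemma sink_radius_pos: "0 < sink_radius"
  using \<alpha>_pos m_pos by (simp add: sink_radius_def)

lemma sink_radius_powr: "sink_radius powr - \<alpha> = 1 / (\<alpha> * m)"
  using \<alpha>_pos m_pos by (simp add: sink_radius_def powr_powr powr_minus field_simps)

lemma sink_radius_unique:
  assumes "0 < r" "m * r powr - \<alpha> = 1 / \<alpha>"
  shows "r = sink_radius"
proof -
  have "r powr \<alpha> = \<alpha> * m"
    using assms \<alpha>_pos m_pos by (simp add: powr_minus field_simps)
  then have "(r powr \<alpha>) powr (1 / \<alpha>) = sink_radius" by (simp add: sink_radius_def)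
  then show ?thesis using assms(1) \<alpha>_pos by (simp add: powr_powr)
qed

lemma stagnation_rcis_iff:
  assumes "0 < r"
  shows "stagnation_point F (rcis r \<theta>) \<longleftrightarrow> \<psi> \<theta> = 0 \<and> - deriv \<psi> \<theta> * r powr - \<alpha> = 1 / \<alpha>"
proof -
  have "stagnation_point F (rcis r \<theta>) \<longleftrightarrow>
      Complex (- deriv \<psi> \<theta> * r powr - \<alpha> - 1 / \<alpha>) (lam * \<psi> \<theta> * r powr - \<alpha>) = 0"
    using assms unfolding stagnation_point_def F_rcis[OF assms] by simp
  then show ?thesis using assms lam by (auto simp: complex_eq_iff)
qed

text \<open>The angular component vanishes only at nodes. The radial one is negative on the rays through the
  even nodes, and on the rays through the odd nodes it vanishes at a single radius.\<close>

lemma stagnation_points: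
  "{\<xi>. \<xi> \<noteq> 0 \<and> stagnation_point F \<xi>} = (\<lambda>i. rcis sink_radius (t i)) ` {i. i < 2 * k \<and> odd i}"
proof (intro set_eqI iffI)
  fix \<xi> assume "\<xi> \<in> {\<xi>. \<xi> \<noteq> 0 \<and> stagnation_point F \<xi>}"
  then have \<xi>: "\<xi> \<noteq> 0" "stagnation_point F \<xi>" by auto
  define r \<theta> where "r = cmod \<xi>" and "\<theta> = Arg \<xi>"
  have r: "0 < r" "\<xi> = rcis r \<theta>" using \<xi>(1) by (simp_all add: r_def \<theta>_def rcis_cmod_Arg)
  have st: "\<psi> \<theta> = 0" "- deriv \<psi> \<theta> * r powr - \<alpha> = 1 / \<alpha>"
    using \<xi>(2) stagnation_rcis_iff[OF r(1)] unfolding r(2) by auto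
  obtain i n where i: "i < 2 * k" "\<theta> + 2 * pi * of_int n = t i"
    by (rule zero_is_node[OF st(1)])
  have slope: "deriv \<psi> \<theta> = (-1) ^ i * m"
    using node(4)[OF i(1)] shift_int(2)[of \<theta> n] i(2) by simp
  have "odd i"
  proof
    assume "even i"
    then have "- m * r powr - \<alpha> = 1 / \<alpha>" using st(2) slope by simp
    moreover have "0 < m * r powr - \<alpha>" "0 < 1 / \<alpha>" using m_pos r(1) \<alpha>_pos by auto
    ultimately show False by simp
  qed
  then have "r = sink_radius"
    using st(2) slope by (intro sink_radius_unique[OF r(1)]) simp
  moreover have "cis \<theta> = cis (t i)"
    unfolding i(2)[symmetric] by (simp add: cis_mult[symmetric] cis_multiple_2pi)
  ultimately have "\<xi> = rcis sink_radius (t i)" using r(2) by (simp add: rcis_def)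
  then show "\<xi> \<in> (\<lambda>i. rcis sink_radius (t i)) ` {i. i < 2 * k \<and> odd i}"
    using i(1) \<open>odd i\<close> by blast
next
  fix \<xi> assume "\<xi> \<in> (\<lambda>i. rcis sink_radius (t i)) ` {i. i < 2 * k \<and> odd i}"
  then obtain i where i: "i < 2 * k" "odd i" "\<xi> = rcis sink_radius (t i)" by auto
  then show "\<xi> \<in> {\<xi>. \<xi> \<noteq> 0 \<and> stagnation_point F \<xi>}"
    using node(2,4)[OF i(1)] sink_radius_pos sink_radius_powr m_pos
    by (simp add: stagnation_rcis_iff)
qed

lemma inj_stagnation: "inj_on (\<lambda>i. rcis sink_radius (t i)) {i. i < 2 * k \<and> odd i}"
  using sink_radius_pos by (intro inj_onI node_cis_inj) (auto simp: rcis_def)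

text \<open>Since \<open>sink_radius powr - \<alpha> = 1 / (\<alpha> * m)\<close>, the field takes the normalised form with
  \<open>f \<tau> = \<psi> (t i + \<tau>) / m\<close>, and \<open>f' 0 = -1\<close> because the node is odd.\<close>

lemma odd_node_asymptotically_stable:
  assumes i: "i < 2 * k" "odd i"
  shows "asymptotically_stable F (rcis sink_radius (t i))"
proof -
  let ?p = "rcis sink_radius (t i)"
  let ?f = "\<lambda>\<tau>. \<psi> (t i + \<tau>) / m" and ?f' = "\<lambda>\<tau>. deriv \<psi> (t i + \<tau>) / m"
  interpret attracting_profile lam \<alpha> ?f ?f'
  proof
    show "(?f has_real_derivative ?f' \<tau>) (at \<tau>)" for \<tau>
      using DERIV_cdivide[OF has_deriv[of "t i + \<tau>", unfolded add.commute[of "t i"] DERIV_shift], of m]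
      by (simp add: add.commute)
    have "isCont (\<lambda>\<tau>. deriv \<psi> (t i + \<tau>)) 0"
      using node(5)[OF i(1)] by (intro isCont_o2[of _ "\<lambda>\<tau>. t i + \<tau>" "deriv \<psi>"] continuous_intros) simp
    then show "isCont ?f' 0"
      using m_pos by (intro continuous_intros) auto
  qed (use lam \<alpha> node[OF i(1)] i(2) m_pos in auto)
  interpret log_coordinate lam \<alpha> ?f ?f' F ?p
  proof
    show "?p \<noteq> 0" using sink_radius_pos by simp
    fix w
    define r where "r = sink_radius * exp (Re w)"
    have r: "0 < r" using sink_radius_pos by (simp add: r_def)
    have r_powr: "r powr - \<alpha> = exp (- \<alpha> * Re w) / (\<alpha> * m)"
      using sink_radius_powr sink_radius_pos by (simp add: r_def powr_mult exp_powr_real mult.commute)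
    have p_exp: "?p * exp w = rcis r (t i + Im w)"
      by (simp add: r_def rcis_def exp_eq_polar cis_mult[symmetric] mult_ac)
    show "F (?p * exp w) = ?p * exp w * log_field w"
      unfolding p_exp F_rcis[OF r] r_powr log_field_def
      using m_pos \<alpha>_pos by (simp add: field_simps)
  qed
  show ?thesis by (rule asymptotically_stable)
qed

text \<open>Where \<open>\<psi>\<close> vanishes the field is radial, and \<open>r' = - \<psi>' \<theta> * r powr (1 - \<alpha>) - r / \<alpha>\<close> becomes
  linear in \<open>g = r powr \<alpha>\<close>.\<close>

lemma radial_trajectory:
  assumes "\<psi> \<theta> = 0"
    and g: "\<And>s. s \<in> I \<Longrightarrow> 0 < g s \<and> (g has_real_derivative - \<alpha> * deriv \<psi> \<theta> - g s) (at s)"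
  shows "trajectory_on F (\<lambda>s. rcis (g s powr (1 / \<alpha>)) \<theta>) I"
  unfolding trajectory_on_def
proof
  fix s assume s: "s \<in> I"
  define r where "r = g s powr (1 / \<alpha>)"
  have r: "0 < r" using g[OF s] by (simp add: r_def)
  have "r powr - \<alpha> = g s powr (- 1)" using \<alpha>_pos by (simp add: r_def powr_powr)
  then have F_r: "F (rcis r \<theta>) = (r * (- deriv \<psi> \<theta> * g s powr - 1 - 1 / \<alpha>)) *\<^sub>R cis \<theta>"
    using assms(1) unfolding F_rcis[OF r] by (simp add: complex_eq_iff)
  have "((\<lambda>s. g s powr (1 / \<alpha>)) has_real_derivative
      1 / \<alpha> * g s powr (1 / \<alpha> - 1) * (- \<alpha> * deriv \<psi> \<theta> - g s)) (at s)"
    using g[OF s] by (intro DERIV_chain2[OF has_real_derivative_powr]) auto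
  moreover have "r = g s * g s powr (1 / \<alpha> - 1)"
    using g[OF s] by (simp add: r_def powr_mult_base)
  then have "1 / \<alpha> * g s powr (1 / \<alpha> - 1) * (- \<alpha> * deriv \<psi> \<theta> - g s)
      = r * (- deriv \<psi> \<theta> * g s powr - 1 - 1 / \<alpha>)"
    using g[OF s] \<alpha>_pos by (simp add: powr_minus_divide right_diff_distrib)
  ultimately have der: "((\<lambda>s. g s powr (1 / \<alpha>)) has_real_derivative
      r * (- deriv \<psi> \<theta> * g s powr - 1 - 1 / \<alpha>)) (at s within I)"
    by (simp add: has_field_derivative_at_within)
  have "((\<lambda>s. (g s powr (1 / \<alpha>)) *\<^sub>R cis \<theta>) has_vector_derivative
      (r * (- deriv \<psi> \<theta> * g s powr - 1 - 1 / \<alpha>)) *\<^sub>R cis \<theta>) (at s within I)"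
    using has_vector_derivative_scaleR[OF der has_vector_derivative_const[of "cis \<theta>"]] by simp
  then show "((\<lambda>s. rcis (g s powr (1 / \<alpha>)) \<theta>) has_vector_derivative F (rcis (g s powr (1 / \<alpha>)) \<theta>))
      (at s within I)"
    unfolding F_r[unfolded r_def] by (simp add: rcis_def scaleR_conv_of_real r_def)
qed

lemma radial_limit:
  assumes "(g \<longlongrightarrow> 0) G" "\<forall>\<^sub>F s in G. 0 < (g s :: real)"
  shows "((\<lambda>s. rcis (g s powr (1 / \<alpha>)) \<theta>) \<longlongrightarrow> 0) G"
proof -
  have "((\<lambda>s. g s powr (1 / \<alpha>)) \<longlongrightarrow> 0 powr (1 / \<alpha>)) G"
    using assms \<alpha>_pos by (intro tendsto_powr') (auto elim: eventually_mono)
  then have "((\<lambda>s. of_real (g s powr (1 / \<alpha>)) * cis \<theta>) \<longlongrightarrow> of_real 0 * cis \<theta>) G"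
    by (intro tendsto_intros) simp
  then show ?thesis by (simp add: rcis_def)
qed

lemma rcis_in_open_ray: "0 < r \<Longrightarrow> rcis r \<theta> \<in> open_ray \<theta>"
  by (auto simp: open_ray_def)

text \<open>Here \<open>\<psi>' = m\<close>, and \<open>g' = - \<alpha> * m - g\<close> has a solution that decreases to \<open>0\<close> at time \<open>0\<close>.\<close>

lemma enters_along_node_0: "enters_origin_along F (t 0)"
proof -
  have k: "0 < 2 * k" using k_pos by simp
  define g where "g s = \<alpha> * m * (exp (- s) - 1)" for s :: real
  have g_pos: "0 < g s" if "s < 0" for s using that \<alpha>_pos m_pos by (simp add: g_def)
  have g_der: "(g has_real_derivative - \<alpha> * m - g s) (at s)" for s
    unfolding g_def by (auto intro!: derivative_eq_intros simp: algebra_simps)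
  have "trajectory_on F (\<lambda>s. rcis (g s powr (1 / \<alpha>)) (t 0)) {-1..<0}"
    using g_pos g_der node(2,4)[OF k] by (intro radial_trajectory) auto
  moreover have "isCont g 0" using g_der by (rule DERIV_isCont)
  then have "(g \<longlongrightarrow> 0) (at_left 0)"
    by (auto simp: continuous_at g_def intro: tendsto_within_subset)
  then have "((\<lambda>s. rcis (g s powr (1 / \<alpha>)) (t 0)) \<longlongrightarrow> 0) (at_left 0)"
    by (rule radial_limit) (auto simp: eventually_at_filter g_pos)
  moreover have "rcis (g s powr (1 / \<alpha>)) (t 0) \<in> open_ray (t 0)" if "s < 0" for s
    using g_pos[OF that] by (intro rcis_in_open_ray) simp
  ultimately show ?thesis
    unfolding enters_origin_along_def
    by (intro exI[where x = "-1"] exI[where x = "0 :: real"] exI[where x = "\<lambda>s. rcis (g s powr (1 / \<alpha>)) (t 0)"]) auto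
qed

text \<open>Here \<open>\<psi>' = - m\<close>, and \<open>g' = \<alpha> * m - g\<close> has a solution that grows from \<open>0\<close> at time \<open>0\<close>.\<close>

lemma leaves_along_node_1: "leaves_origin_along F (t 1)"
proof -
  have k: "1 < 2 * k" using k_pos by simp
  define g where "g s = \<alpha> * m * (1 - exp (- s))" for s :: real
  have g_pos: "0 < g s" if "0 < s" for s using that \<alpha>_pos m_pos by (simp add: g_def)
  have g_der: "(g has_real_derivative - \<alpha> * - m - g s) (at s)" for s
    unfolding g_def by (auto intro!: derivative_eq_intros simp: algebra_simps)
  have "trajectory_on F (\<lambda>s. rcis (g s powr (1 / \<alpha>)) (t 1)) {0<..1}"
    using g_pos g_der node(2,4)[OF k] by (intro radial_trajectory) auto
  moreover have "isCont g 0" using g_der by (rule DERIV_isCont)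
  then have "(g \<longlongrightarrow> 0) (at_right 0)"
    by (auto simp: continuous_at g_def intro: tendsto_within_subset)
  then have "((\<lambda>s. rcis (g s powr (1 / \<alpha>)) (t 1)) \<longlongrightarrow> 0) (at_right 0)"
    by (rule radial_limit) (auto simp: eventually_at_filter g_pos)
  moreover have "rcis (g s powr (1 / \<alpha>)) (t 1) \<in> open_ray (t 1)" if "0 < s" for s
    using g_pos[OF that] by (intro rcis_in_open_ray) simp
  ultimately show ?thesis
    unfolding leaves_origin_along_def
    by (intro exI[of _ "0"] exI[of _ "\<lambda>s. rcis (g s powr (1 / \<alpha>)) (t 1)"] exI[of _ 1]) auto
qed

lemma origin_is_saddle: "origin_is_saddle F"
proof -
  have k: "0 < 2 * k" "1 < 2 * k" using k_pos by auto
  have "open_ray (t 0) \<noteq> open_ray (t 1)"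
  proof
    assume eq: "open_ray (t 0) = open_ray (t 1)"
    have "rcis 1 (t 0) \<in> open_ray (t 0)" unfolding open_ray_def by force
    then obtain r where r: "0 < r" "cis (t 0) = rcis r (t 1)"
      unfolding eq by (auto simp: open_ray_def cis_rcis_eq)
    have "cmod (cis (t 0)) = cmod (rcis r (t 1))" by (rule arg_cong[OF r(2)])
    then have "r = 1" using r(1) by simp
    then have "cis (t 0) = cis (t 1)" using r(2) by (simp add: rcis_def)
    then show False using node_cis_inj[OF k] by simp
  qed
  then show ?thesis
    unfolding origin_is_saddle_def stagnation_point_def
    using F_origin enters_along_node_0 leaves_along_node_1 by blast
qed

end

theorem theorem3p5:
  fixes lam \<alpha> P :: real and k :: nat and \<psi> :: "real \<Rightarrow> real" and F :: "complex \<Rightarrow> complex"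
  assumes "1 < lam" "lam < 2" and "\<alpha> = 2 - lam" and "P < 0"
    and "glued_solution lam P k \<psi>"
    and "F = pseudo_velocity \<alpha> (homogeneous_stream lam \<psi>)"
  shows "(\<forall>\<theta>. changes_pos_to_neg_at \<psi> \<theta> \<longrightarrow> (\<exists>r>0. stagnation_point F (rcis r \<theta>))) \<and>
    finite {\<xi>. \<xi> \<noteq> 0 \<and> stagnation_point F \<xi>} \<and>
    card {\<xi>. \<xi> \<noteq> 0 \<and> stagnation_point F \<xi>} = k \<and>
    (\<forall>\<xi>. \<xi> \<noteq> 0 \<longrightarrow> stagnation_point F \<xi> \<longrightarrow>
       sink F \<xi> \<and> cmod \<xi> = \<alpha> powr (1 / \<alpha>) * (- 2 * P) powr (1 / (2 * \<alpha>))) \<and>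
    origin_is_saddle F"
proof -
  obtain t where t: "nodal_profile (sqrt (- 2 * P)) k \<psi> t"
    by (rule glued_solution_nodal_profile[OF \<open>1 < lam\<close> \<open>P < 0\<close> \<open>glued_solution lam P k \<psi>\<close>])
  interpret self_similar_flow "sqrt (- 2 * P)" k \<psi> t lam \<alpha> F
    by unfold_locales (use assms t in auto)
  have "sqrt (- 2 * P) powr (1 / \<alpha>) = (- 2 * P) powr (1 / (2 * \<alpha>))"
    using \<open>P < 0\<close> by (simp add: powr_half_sqrt[symmetric] powr_powr)
  then have radius: "sink_radius = \<alpha> powr (1 / \<alpha>) * (- 2 * P) powr (1 / (2 * \<alpha>))"
    unfolding sink_radius_def using \<open>P < 0\<close> \<alpha>_pos by (simp add: powr_mult)
  show ?thesis
  proof (intro conjI allI impI)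
    fix \<theta> assume "changes_pos_to_neg_at \<psi> \<theta>"
    then obtain i n where i: "i < 2 * k" "odd i" "\<theta> + 2 * pi * of_int n = t i"
      by (rule changes_sign_at_odd_node)
    then have "\<psi> \<theta> = 0" "deriv \<psi> \<theta> = - sqrt (- 2 * P)"
      using shift_int[of \<theta> n] node(2,4)[OF i(1)] by simp_all
    then have "stagnation_point F (rcis sink_radius \<theta>)"
      using sink_radius_pos sink_radius_powr m_pos by (simp add: stagnation_rcis_iff)
    then show "\<exists>r>0. stagnation_point F (rcis r \<theta>)" using sink_radius_pos by blast
  next
    show "finite {\<xi>. \<xi> \<noteq> 0 \<and> stagnation_point F \<xi>}"
      unfolding stagnation_points using card_odd_below(2) by (rule finite_imageI)
    show "card {\<xi>. \<xi> \<noteq> 0 \<and> stagnation_point F \<xi>} = k"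
      unfolding stagnation_points card_image[OF inj_stagnation] by (rule card_odd_below(1))
  next
    fix \<xi> assume "\<xi> \<noteq> 0" and st: "stagnation_point F \<xi>"
    then have "\<xi> \<in> (\<lambda>i. rcis sink_radius (t i)) ` {i. i < 2 * k \<and> odd i}"
      unfolding stagnation_points[symmetric] by simp
    then obtain i where i: "i < 2 * k" "odd i" "\<xi> = rcis sink_radius (t i)" by auto
    show "sink F \<xi>"
      using st odd_node_asymptotically_stable[OF i(1,2)] by (simp add: sink_def i(3))
    show "cmod \<xi> = \<alpha> powr (1 / \<alpha>) * (- 2 * P) powr (1 / (2 * \<alpha>))"
      using i(3) sink_radius_pos radius by simp
  next
    show "origin_is_saddle F" by (rule origin_is_saddle)
  qed
qed

end
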